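(* Let $c=5.4806$ and $d=27$. Then asymptotically almost surely $\mathcal{G}_{cn,d}\to P_n$. Consequently $\hat{R}(P_n)<74n$ for all sufficiently large $n$.
   Context: $\mathcal{G}_{N,d}$ is the uniform probability space of $d$-regular graphs on $N$ vertices (here $N=cn$, rounded to an even integer since $d$ is odd). $P_n$ is the path on $n$ vertices; $G\to P_n$ means every 2-colouring of the edges of $G$ contains a monochromatic copy of $P_n$; $\hat{R}(P_n)=\min\{|E(G)|:G\to P_n\}$. Asymptotically almost surely (a.a.s.) means with probability tending to $1$ as $n\to\infty$. *)

theory Defs
  imports "HOL-Probability.Probability_Mass_Function"
begin

datatype 'a graph = Graph (verts: "'a set") (edges: "'a set set")

definition simple_graph :: "'a graph \<Rightarrow> bool" where
  "simple_graph G \<longleftrightarrow> (\<forall>e\<in>edges G. e \<subseteq> verts G \<and> card e = 2)"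

definition vertex_degree :: "'a graph \<Rightarrow> 'a \<Rightarrow> nat" where
  "vertex_degree G v = card {e \<in> edges G. v \<in> e}"

definition regular_graphs :: "nat \<Rightarrow> nat \<Rightarrow> nat graph set" where
  "regular_graphs N d =
     {G. simple_graph G \<and> verts G = {..<N} \<and> (\<forall>v\<in>verts G. vertex_degree G v = d)}"

(* The uniform probability space of labelled d-regular graphs on N vertices.  It is meaningful
   only if such graphs exist (d < N and d * N even); otherwise pmf_of_set is unspecified. *)
definition random_regular_graph :: "nat \<Rightarrow> nat \<Rightarrow> nat graph pmf" where
  "random_regular_graph N d = pmf_of_set (regular_graphs N d)"

definition path_graph :: "nat \<Rightarrow> nat graph" where
  "path_graph n = Graph {..<n} {{i, Suc i} | i. Suc i < n}"

(* f embeds H onto a (not necessarily induced) subgraph of G *)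
definition is_copy :: "('b \<Rightarrow> 'a) \<Rightarrow> 'b graph \<Rightarrow> 'a graph \<Rightarrow> bool" where
  "is_copy f H G \<longleftrightarrow>
     inj_on f (verts H) \<and> f ` verts H \<subseteq> verts G \<and> (\<forall>e\<in>edges H. f ` e \<in> edges G)"

(* The two colours are the truth values; values of a colouring outside edges G are irrelevant. *)
definition arrows :: "'a graph \<Rightarrow> 'b graph \<Rightarrow> bool" where
  "arrows G H \<longleftrightarrow>
     (\<forall>col :: 'a set \<Rightarrow> bool. \<exists>f k. is_copy f H G \<and> (\<forall>e\<in>edges H. col (f ` e) = k))"

(* Every finite graph is isomorphic to one with vertices in nat, so the minimum may be
   taken over those. *)
definition size_ramsey :: "'b graph \<Rightarrow> nat" where
  "size_ramsey H =
     (LEAST m. \<exists>G :: nat graph.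
        finite (verts G) \<and> simple_graph G \<and> arrows G H \<and> card (edges G) = m)"

(* m is x rounded, up or down, to an even integer: one of the (at most two) even integers
   at distance less than 2 from x. *)
definition even_rounding :: "real \<Rightarrow> nat \<Rightarrow> bool" where
  "even_rounding x m \<longleftrightarrow> even m \<and> \<bar>real m - x\<bar> < 2"

end

(* If a two-coloured graph G on N vertices has no monochromatic path on n vertices, halting a
   depth-first search in the first colour when the abandoned and the unexplored sets have equal
   size gives two such sets X, Y with no edge of the first colour between them.  Halting in the
   same way a search in the second colour, restricted to the bipartite graph between X and Y,
   splits both: there are disjoint S1, S2, S3, S4 with |S1| = |S2|, |S3| = |S4|,
   |S1| + |S3| >= (N - 2n + 2) / 2 and no edge of G at all between S1 and S2 or between S3 and S4.

   Such a pair of holes is excluded by a first moment estimate.  A d-regular graph is encoded by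
   lists of dN/2 ordered pairs in which every vertex occurs d times; all d-regular graphs have the
   same number of codes.  Lists avoiding the holes are bounded by a generating function in one
   variable per vertex class, with the exact factor for the degrees.  At least a polynomial
   fraction of all lists codes a simple graph: the mean number of loops and repetitions is
   bounded, and each switching, which has at most (dN/2)^2 preimages, removes one of them.  With
   |S1| + |S3| = lN the result is poly(N) * exp(N * rate l), uniformly in |S1|, because the
   variables for the two holes are chosen proportional to the sizes of the holes.  For d = 27 and
   l slightly below (c - 2) / (2c) the rate is negative, but only by about 2e-5. *)

theory Submission
  imports Defs
begin

section \<open>Depth-first search and holes\<close>

text \<open>The margin in the rate is so small that no exponential loss can be afforded: counting
  the placements of the holes, estimating factorials and passing to simple lists may each cost only
  a power of \<open>N\<close>. This dictates the choice of the generating function variables. Taken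
  proportional to the class sizes \<open>s t\<close>, they produce the powers
  \<open>s t ^ (d * s t)\<close>, which cancel against the class factorials
  \<open>fact (d * s t)\<close>, so that of the variables only the tuning factor
  \<open>\<kappa>\<close> of the hole classes survives. The way in which the total size
  \<open>L\<close> is split into hole sizes \<open>A\<close> and \<open>B\<close> is harmless
  because the equal split is the worst one twice: it minimises \<open>A ^ A * B ^ B\<close>, whose
  square divides the bound for the number of placements, and it minimises \<open>A^2 + B^2\<close>,
  which measures the weight of the forbidden pairs. Hence one value of the rate serves all splits,
  and summing over them costs a factor \<open>L + 1\<close>.\<close>

definition adj_path :: "('a \<Rightarrow> 'a \<Rightarrow> bool) \<Rightarrow> 'a list \<Rightarrow> bool" where
  "adj_path E xs \<longleftrightarrow> distinct xs \<and> (\<forall>i. Suc i < length xs \<longrightarrow> E (xs ! i) (xs ! Suc i))"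

lemma adj_path_Nil [simp]: "adj_path E []"
  by (simp add: adj_path_def)

lemma adj_path_Cons:
  "adj_path E (x # xs) \<longleftrightarrow> x \<notin> set xs \<and> (xs \<noteq> [] \<longrightarrow> E x (hd xs)) \<and> adj_path E xs"
proof -
  have "(\<forall>i. Suc i < length (x # xs) \<longrightarrow> E ((x # xs) ! i) ((x # xs) ! Suc i)) \<longleftrightarrow>
     (xs \<noteq> [] \<longrightarrow> E x (hd xs)) \<and> (\<forall>i. Suc i < length xs \<longrightarrow> E (xs ! i) (xs ! Suc i))"
    (is "?l \<longleftrightarrow> ?r")
  proof
    assume l: ?l
    show ?r
      using l[rule_format, of 0] l[rule_format, of "Suc _"] by (auto simp: hd_conv_nth)
  next
    assume r: ?r
    show ?l
    proof (intro allI impI)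
      fix i assume "Suc i < length (x # xs)"
      then show "E ((x # xs) ! i) ((x # xs) ! Suc i)"
        using r by (cases i) (auto simp: hd_conv_nth)
    qed
  qed
  then show ?thesis by (auto simp: adj_path_def)
qed

text \<open>\<open>D\<close> holds the abandoned vertices, \<open>xs\<close> is the current path, growing at its head, and \<open>U\<close> is unexplored.\<close>

definition dfs_state :: "('a \<Rightarrow> 'a \<Rightarrow> bool) \<Rightarrow> 'a set \<Rightarrow> 'a set \<Rightarrow> 'a list \<Rightarrow> 'a set \<Rightarrow> bool" where
  "dfs_state E V D xs U \<longleftrightarrow> V = D \<union> set xs \<union> U \<and> D \<inter> set xs = {} \<and> D \<inter> U = {} \<and> set xs \<inter> U = {} \<and>
     adj_path E xs \<and> (\<forall>x\<in>D. \<forall>y\<in>U. \<not> E x y)"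

text \<open>\<open>2 * card D + length xs\<close> grows by one with every move of the search, hence takes every value.\<close>

lemma dfs_state_exists:
  assumes fin: "finite V" and sym: "\<And>x y. E x y \<Longrightarrow> E y x" and "t \<le> 2 * card V"
  shows "\<exists>D xs U. dfs_state E V D xs U \<and> 2 * card D + length xs = t"
  using assms(3)
proof (induction t)
  case 0
  have "dfs_state E V {} [] V" by (simp add: dfs_state_def)
  then show ?case by force
next
  case (Suc t)
  then obtain D xs U where st: "dfs_state E V D xs U" and t: "2 * card D + length xs = t"
    by auto
  from st have V: "V = D \<union> set xs \<union> U" and dis: "D \<inter> set xs = {}" "D \<inter> U = {}" "set xs \<inter> U = {}"
    and p: "adj_path E xs" and no: "\<forall>x\<in>D. \<forall>y\<in>U. \<not> E x y"
    by (auto simp: dfs_state_def)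
  have finD: "finite D" using fin V by auto
  show ?case
  proof (cases xs)
    case Nil
    have "U \<noteq> {}"
    proof
      assume "U = {}"
      with V Nil t have "t = 2 * card V" by simp
      with Suc.prems show False by simp
    qed
    then obtain r where r: "r \<in> U" by auto
    have "dfs_state E V D [r] (U - {r})"
      using V dis no r Nil by (auto simp: dfs_state_def adj_path_Cons)
    then show ?thesis using t Nil by (intro exI[of _ D] exI[of _ "[r]"] exI) auto
  next
    case (Cons x ys)
    show ?thesis
    proof (cases "\<exists>r\<in>U. E x r")
      case True
      then obtain r where r: "r \<in> U" "E x r" by auto
      have "dfs_state E V D (r # xs) (U - {r})"
        using V dis no p r Cons sym[OF r(2)] by (auto simp: dfs_state_def adj_path_Cons[of _ r])
      then show ?thesis using t by (intro exI[of _ D] exI[of _ "r # xs"] exI) auto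
    next
      case False
      have "dfs_state E V (insert x D) ys U"
        using V dis no p Cons False by (auto simp: dfs_state_def adj_path_Cons)
      moreover have "card (insert x D) = Suc (card D)"
        using finD dis Cons by auto
      ultimately show ?thesis using t Cons
        by (intro exI[of _ "insert x D"] exI[of _ ys] exI) auto
    qed
  qed
qed

text \<open>Stopping when \<open>2 * card D + length xs\<close> equals \<open>card V\<close>, which
  is \<open>card D + length xs + card U\<close>, forces \<open>card D = card U\<close>.\<close>

lemma dfs_state_halving:
  assumes fin: "finite V" and sym: "\<And>x y. E x y \<Longrightarrow> E y x"
  obtains D xs U where "dfs_state E V D xs U" "card D = card U" "card V = 2 * card D + length xs"
proof -
  obtain D xs U where st: "dfs_state E V D xs U" and t: "2 * card D + length xs = card V"
    using dfs_state_exists[of V E "card V"] assms by auto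
  have "finite D" "finite U" using st fin by (auto simp: dfs_state_def)
  have "card V = card D + length xs + card U"
    using st \<open>finite D\<close> \<open>finite U\<close>
    by (auto simp: dfs_state_def card_Un_disjoint Int_Un_distrib2 adj_path_def distinct_card)
  with t that st show thesis by auto
qed

text \<open>A path in a bipartite graph changes sides at every step. This is what makes the second
  search split both sides of the bipartition evenly.\<close>

lemma alternating_path_balanced:
  assumes "adj_path (\<lambda>x y. x \<in> X \<longleftrightarrow> y \<notin> X) xs"
  shows "\<bar>int (length (filter (\<lambda>x. x \<in> X) xs)) - int (length (filter (\<lambda>x. x \<notin> X) xs))\<bar> \<le> 1"
proof -
  \<comment> \<open>Strengthened for the induction: the side of the head decides which sign the
    difference may have.\<close>
  have "(xs \<noteq> [] \<and> hd xs \<in> X \<longrightarrow> int (length (filter (\<lambda>x. x \<in> X) xs)) - int (length (filter (\<lambda>x. x \<notin> X) xs)) \<in> {0, 1}) \<and>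
    (xs \<noteq> [] \<and> hd xs \<notin> X \<longrightarrow> int (length (filter (\<lambda>x. x \<in> X) xs)) - int (length (filter (\<lambda>x. x \<notin> X) xs)) \<in> {0, -1})"
    using assms
  proof (induction xs)
    case (Cons x xs)
    then show ?case by (cases "xs = []") (auto simp: adj_path_Cons)
  qed simp
  then show ?thesis by (cases "xs = []") auto
qed

lemma adj_path_mono: "adj_path E xs \<Longrightarrow> (\<And>x y. E x y \<Longrightarrow> F x y) \<Longrightarrow> adj_path F xs"
  by (auto simp: adj_path_def)

lemma mono_path_copy:
  assumes p: "adj_path (\<lambda>x y. {x, y} \<in> edges G \<and> col {x, y} = k) xs"
    and sub: "set xs \<subseteq> verts G" and n: "n \<le> length xs"
  shows "\<exists>f. is_copy f (path_graph n) G \<and> (\<forall>e\<in>edges (path_graph n). col (f ` e) = k)"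
proof (intro exI conjI)
  have "\<And>i. Suc i < n \<Longrightarrow> {xs ! i, xs ! Suc i} \<in> edges G \<and> col {xs ! i, xs ! Suc i} = k"
    using p n by (auto simp: adj_path_def)
  then show "\<forall>e\<in>edges (path_graph n). col ((!) xs ` e) = k"
    by (auto simp: path_graph_def)
  show "is_copy ((!) xs) (path_graph n) G"
    using p n sub \<open>\<And>i. Suc i < n \<Longrightarrow> _\<close>
    by (auto simp: is_copy_def path_graph_def adj_path_def inj_on_def nth_eq_iff_index_eq)
qed

lemma not_arrows_path_holes:
  fixes G :: "'a graph"
  assumes fin: "finite (verts G)" and na: "\<not> arrows G (path_graph n)"
  obtains S1 S2 S3 S4 where
    "S1 \<subseteq> verts G" "S2 \<subseteq> verts G" "S3 \<subseteq> verts G" "S4 \<subseteq> verts G"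
    "S1 \<inter> S2 = {}" "S1 \<inter> S3 = {}" "S1 \<inter> S4 = {}" "S2 \<inter> S3 = {}" "S2 \<inter> S4 = {}" "S3 \<inter> S4 = {}"
    "card S1 = card S2" "card S3 = card S4"
    "card (verts G) + 2 \<le> 2 * (card S1 + card S3) + 2 * n"
    "\<And>x y. x \<in> S1 \<Longrightarrow> y \<in> S2 \<Longrightarrow> {x, y} \<notin> edges G"
    "\<And>x y. x \<in> S3 \<Longrightarrow> y \<in> S4 \<Longrightarrow> {x, y} \<notin> edges G"
proof -
  from na obtain col :: "'a set \<Rightarrow> bool" where col:
    "\<nexists>f k. is_copy f (path_graph n) G \<and> (\<forall>e\<in>edges (path_graph n). col (f ` e) = k)"
    unfolding arrows_def by blast
  have short: "length xs < n"
    if "adj_path (\<lambda>x y. {x, y} \<in> edges G \<and> col {x, y} = k) xs" "set xs \<subseteq> verts G" for xs k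
  proof (rule ccontr)
    assume "\<not> length xs < n"
    then have "n \<le> length xs" by simp
    from mono_path_copy[OF that this] col show False by blast
  qed
  define B where "B x y \<longleftrightarrow> {x, y} \<in> edges G \<and> col {x, y} = True" for x y
  have "B y x" if "B x y" for x y using that by (simp add: B_def insert_commute)
  then obtain X ps Y where st: "dfs_state B (verts G) X ps Y" and XY: "card X = card Y"
    and cV: "card (verts G) = 2 * card X + length ps"
    using dfs_state_halving[OF fin, of B] by metis
  have ps: "length ps < n"
    using st by (intro short[of True]) (auto simp: dfs_state_def B_def elim!: adj_path_mono)
  define E where "E x y \<longleftrightarrow> ({x, y} \<in> edges G \<and> col {x, y} = False) \<and> (x \<in> X \<longleftrightarrow> y \<notin> X)" for x y
  have sym: "E y x" if "E x y" for x y using that by (auto simp: E_def insert_commute)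
  have finXY: "finite X" "finite Y" using st fin by (auto simp: dfs_state_def)
  have dXY: "X \<inter> Y = {}" using st by (auto simp: dfs_state_def)
  obtain D qs U where st2: "dfs_state E (X \<union> Y) D qs U" and DU: "card D = card U"
    and cXY: "card (X \<union> Y) = 2 * card D + length qs"
    using dfs_state_halving[of "X \<union> Y" E] finXY sym by (metis finite_Un)
  have qp: "adj_path E qs" and qs: "set qs \<subseteq> X \<union> Y" "D \<subseteq> X \<union> Y" "U \<subseteq> X \<union> Y"
    and un: "X \<union> Y = D \<union> set qs \<union> U"
    and dis: "D \<inter> set qs = {}" "D \<inter> U = {}" "set qs \<inter> U = {}"
    and noE: "\<And>x y. x \<in> D \<Longrightarrow> y \<in> U \<Longrightarrow> \<not> E x y"
    using st2 by (auto simp: dfs_state_def)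
  have VXY: "X \<union> Y \<subseteq> verts G" using st by (auto simp: dfs_state_def)
  have "length qs < n"
    using qs VXY by (intro short[of False] adj_path_mono[OF qp]) (auto simp: E_def)
  have distq: "distinct qs" using qp by (simp add: adj_path_def)
  have finDU: "finite D" "finite U" using qs finXY by (meson finite_Un finite_subset)+
  define qX where "qX = length (filter (\<lambda>x. x \<in> X) qs)"
  define qY where "qY = length (filter (\<lambda>x. x \<notin> X) qs)"
  have bal: "\<bar>int qX - int qY\<bar> \<le> 1"
    unfolding qX_def qY_def
    by (rule alternating_path_balanced, rule adj_path_mono[OF qp]) (auto simp: E_def)
  have qXY: "length qs = qX + qY"
    unfolding qX_def qY_def by (rule sum_length_filter_compl[symmetric])
  have qXc: "qX = card (set qs \<inter> X)"
    unfolding qX_def using distinct_card[of "filter (\<lambda>x. x \<in> X) qs"] distq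
    by (auto simp: Int_def)
  have "set qs - X = set qs \<inter> Y" using qs dXY by auto
  moreover have "{x \<in> set qs. x \<notin> X} = set qs - X" by auto
  ultimately have qYc: "qY = card (set qs \<inter> Y)"
    unfolding qY_def using distinct_card[of "filter (\<lambda>x. x \<notin> X) qs"] distq
    by auto
  \<comment> \<open>The second search partitions each of \<open>X\<close> and \<open>Y\<close> into
    an abandoned part, a part on the path and an unexplored part.\<close>
  have split3: "card Z = card (D \<inter> Z) + card (set qs \<inter> Z) + card (U \<inter> Z)"
    if "Z \<subseteq> X \<union> Y" for Z
  proof -
    have "Z = (D \<inter> Z) \<union> (set qs \<inter> Z) \<union> (U \<inter> Z)" using that un by auto
    moreover have "card ((D \<inter> Z) \<union> (set qs \<inter> Z) \<union> (U \<inter> Z)) = card (D \<inter> Z) + card (set qs \<inter> Z) + card (U \<inter> Z)"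
      using finDU dis by (subst card_Un_disjoint; (subst card_Un_disjoint)?; auto)
    ultimately show ?thesis by metis
  qed
  have split2: "card Z = card (Z \<inter> X) + card (Z \<inter> Y)" if "finite Z" "Z \<subseteq> X \<union> Y" for Z
  proof -
    have "Z = (Z \<inter> X) \<union> (Z \<inter> Y)" using that by auto
    moreover have "card ((Z \<inter> X) \<union> (Z \<inter> Y)) = card (Z \<inter> X) + card (Z \<inter> Y)"
      using that dXY by (intro card_Un_disjoint) auto
    ultimately show ?thesis by metis
  qed
  note s = split3[of X, folded qXc, OF Un_upper1] split3[of Y, folded qYc, OF Un_upper2] split2[OF finDU(1) qs(2)] split2[OF finDU(2) qs(3)]
  \<comment> \<open>Each of the two paths has at most \<open>n - 1\<close> vertices; the two missing
    vertices give the \<open>+ 2\<close>.\<close>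
  have size_arith: "v + 2 \<le> 2 * (a + b) + 2 * n"
    if "d = a + b" "w = 2 * d + l" "w = 2 * x" "v = 2 * x + m" "m < n" "l < n" for v a b d w x l m :: nat
  proof -
    have "v + 2 = 2 * (a + b) + (l + 1) + (m + 1)" using that(1-4) by simp
    also have "\<dots> \<le> 2 * (a + b) + n + n" using that(5,6) by (intro add_mono) auto
    finally show ?thesis by simp
  qed
  \<comment> \<open>The hypotheses express \<open>card X = card Y\<close>,
    \<open>card D = card U\<close> and the balance of the path. They yield
    \<open>2 * a + p = 2 * e + q\<close>, so \<open>p - q\<close> is even; being at most 1 in
    absolute value, it vanishes.\<close>
  have parity: "a = e \<and> c = b \<and> p = q"
    if "a + p + b = c + q + e" "a + c = b + e" "\<bar>int p - int q\<bar> \<le> 1" for a b c e p q :: nat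
  proof -
    have e: "2 * a + p = 2 * e + q" using that(1,2) by linarith
    have "p = q \<or> p = q + 1 \<or> q = p + 1" using that(3) by arith
    then have "p = q" using e by presburger
    then show ?thesis using e that(1,2) by simp
  qed
  have eq: "card (D \<inter> X) = card (U \<inter> Y)" "card (D \<inter> Y) = card (U \<inter> X)" "qX = qY"
    using parity[of "card (D \<inter> X)" qX "card (U \<inter> X)" "card (D \<inter> Y)" qY "card (U \<inter> Y)"] s XY DU bal
    by auto
  have "card (X \<union> Y) = 2 * card X" using dXY finXY XY by (simp add: card_Un_disjoint)
  then have size: "card (verts G) + 2 \<le> 2 * (card (D \<inter> X) + card (D \<inter> Y)) + 2 * n"
    using size_arith[OF s(3) cXY _ cV ps \<open>length qs < n\<close>] by blast
  show thesis
  \<comment> \<open>Both holes consist of pairs across \<open>X\<close> and \<open>Y\<close>, where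
    the first search excludes colour \<open>True\<close>, and across \<open>D\<close> and
    \<open>U\<close>, where the second excludes colour \<open>False\<close>.\<close>
  proof (rule that[of "D \<inter> X" "U \<inter> Y" "D \<inter> Y" "U \<inter> X"])
    fix x y assume xy: "x \<in> D \<inter> X" "y \<in> U \<inter> Y"
    then have "\<not> B x y" "\<not> E x y" using st noE by (auto simp: dfs_state_def)
    then show "{x, y} \<notin> edges G" using xy dXY by (auto simp: B_def E_def)
  next
    fix x y assume xy: "x \<in> D \<inter> Y" "y \<in> U \<inter> X"
    then have "\<not> B y x" "\<not> E x y" using st noE by (auto simp: dfs_state_def)
    then show "{x, y} \<notin> edges G" using xy dXY by (auto simp: B_def E_def insert_commute)
  qed (use size eq qs VXY dXY dis in auto)
qed

section \<open>Configurations with given degrees\<close>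

definition dec :: "('a \<Rightarrow> nat) \<Rightarrow> 'a \<Rightarrow> 'a \<Rightarrow> nat" where
  "dec f x = f(x := f x - 1)"

primrec deg :: "('a \<times> 'a) list \<Rightarrow> 'a \<Rightarrow> nat" where
  "deg [] = (\<lambda>_. 0)"
| "deg (p # ps) = (\<lambda>x. deg ps x + of_bool (x = fst p) + of_bool (x = snd p))"

text \<open>A list of \<open>k\<close> pairs is a word of \<open>2 * k\<close> vertices with
  prescribed multiplicities. This is the configuration model with the half-edges at each vertex made
  indistinguishable and the pairs ordered and oriented.\<close>

definition configs :: "('a \<times> 'a) set \<Rightarrow> ('a \<Rightarrow> nat) \<Rightarrow> nat \<Rightarrow> ('a \<times> 'a) list set" where
  "configs R f k = {ps. length ps = k \<and> set ps \<subseteq> R \<and> deg ps = f}"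

lemma finite_configs [simp]: "finite R \<Longrightarrow> finite (configs R f k)"
  unfolding configs_def by (rule finite_subset[OF _ finite_lists_length_eq[of R k]]) auto

lemma configs_0: "configs R f 0 = (if f = (\<lambda>_. 0) then {[]} else {})"
  by (auto simp: configs_def)

lemma configs_Suc:
  "configs R f (Suc k) =
     (\<Union>p\<in>{p \<in> R. 0 < f (fst p) \<and> 0 < dec f (fst p) (snd p)}.
        (#) p ` configs R (dec (dec f (fst p)) (snd p)) k)" (is "?l = ?r")
proof (intro equalityI subsetI)
  fix qs assume "qs \<in> ?l"
  then obtain p ps where qs: "qs = p # ps" and p: "p \<in> R" "set ps \<subseteq> R" "length ps = k"
    and f: "f = deg (p # ps)"
    by (auto simp: configs_def length_Suc_conv)
  have "deg ps = dec (dec f (fst p)) (snd p)" "0 < f (fst p)" "0 < dec f (fst p) (snd p)"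
    unfolding f by (auto simp: dec_def fun_eq_iff)
  with p show "qs \<in> ?r" unfolding qs
    by (intro UN_I[of p] imageI) (auto simp: configs_def)
next
  fix qs assume "qs \<in> ?r"
  then obtain p ps where qs: "qs = p # ps" and p: "p \<in> R" "0 < f (fst p)" "0 < dec f (fst p) (snd p)"
    and ps: "ps \<in> configs R (dec (dec f (fst p)) (snd p)) k"
    by auto
  have "deg (p # ps) = f"
    using ps p(2,3) by (auto simp: configs_def dec_def fun_eq_iff split: if_splits)
  with ps p qs show "qs \<in> ?l" by (auto simp: configs_def)
qed

lemma card_configs_Suc:
  assumes "finite R"
  shows "card (configs R f (Suc k)) =
    (\<Sum>p | p \<in> R \<and> 0 < f (fst p) \<and> 0 < dec f (fst p) (snd p).
        card (configs R (dec (dec f (fst p)) (snd p)) k))"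
  unfolding configs_Suc using assms
  by (subst card_UN_disjoint) (auto simp: card_image)

lemma prod_fact_dec:
  assumes "finite V" "x \<in> V" "0 < f x"
  shows "(\<Prod>v\<in>V. fact (f v) :: 'b::{semiring_char_0,comm_semiring_1}) = of_nat (f x) * (\<Prod>v\<in>V. fact (dec f x v))"
proof -
  have "(\<Prod>v\<in>V. fact (f v) :: 'b) = fact (f x) * (\<Prod>v\<in>V - {x}. fact (f v))"
    using assms by (simp add: prod.remove)
  also have "(\<Prod>v\<in>V - {x}. fact (f v) :: 'b) = (\<Prod>v\<in>V - {x}. fact (dec f x v))"
    by (intro prod.cong) (auto simp: dec_def)
  also have "fact (f x) = (of_nat (f x) * fact (dec f x x) :: 'b)"
    using assms by (simp add: dec_def fact_reduce)
  finally show ?thesis using assms by (simp add: prod.remove[of V x] mult.assoc)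
qed

lemma prod_power_dec:
  fixes y :: "'a \<Rightarrow> 'b::comm_semiring_1"
  assumes "finite V" "x \<in> V" "0 < f x"
  shows "(\<Prod>v\<in>V. y v ^ f v) = y x * (\<Prod>v\<in>V. y v ^ dec f x v)"
proof -
  have "(\<Prod>v\<in>V. y v ^ f v) = y x ^ f x * (\<Prod>v\<in>V - {x}. y v ^ f v)"
    using assms by (simp add: prod.remove)
  also have "(\<Prod>v\<in>V - {x}. y v ^ f v) = (\<Prod>v\<in>V - {x}. y v ^ dec f x v)"
    by (intro prod.cong) (auto simp: dec_def)
  also have "y x ^ f x = y x * y x ^ dec f x x"
    using assms by (simp add: dec_def flip: power_Suc)
  finally show ?thesis using assms by (simp add: prod.remove[of V x] mult.assoc)
qed

lemma sum_dec:
  assumes "finite V" "x \<in> V" "0 < f x"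
  shows "sum f V = Suc (sum (dec f x) V)"
proof -
  have "sum f (V - {x}) = sum (dec f x) (V - {x})"
    by (intro sum.cong) (auto simp: dec_def)
  with assms show ?thesis by (simp add: sum.remove[of V x] dec_def)
qed

lemma sum_deg: "finite V \<Longrightarrow> set ps \<subseteq> V \<times> V \<Longrightarrow> sum (deg ps) V = 2 * length ps"
proof (induction ps)
  case (Cons p ps)
  then have "(\<Sum>x\<in>V. of_bool (x = fst p)) = (1::nat)" "(\<Sum>x\<in>V. of_bool (x = snd p)) = (1::nat)"
    by (auto simp: of_bool_def)
  with Cons show ?case by (simp add: sum.distrib)
qed simp

text \<open>The weights vanish where the guards fail. Without guards a sum over all pairs factorises
  into a sum over first and a sum over second endpoints.\<close>

lemma sum_restrict_nonzero:
  assumes "finite R"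
  shows "(\<Sum>p | p \<in> R \<and> 0 < f (fst p) \<and> 0 < dec f (fst p) (snd p).
            of_nat (f (fst p)) * of_nat (dec f (fst p) (snd p)) * h p)
       = (\<Sum>p\<in>R. of_nat (f (fst p)) * of_nat (dec f (fst p) (snd p)) * (h p :: 'b::comm_semiring_1))"
  using assms by (intro sum.mono_neutral_left) (auto intro!: Nat.gr0I)

text \<open>This is the multinomial coefficient for words of length \<open>2 * k\<close>. Removing
  the first pair reduces the factorials by \<open>f u * dec f u v\<close>, and these weights add up
  to \<open>(2 * k + 2) * (2 * k + 1)\<close>.\<close>

lemma card_all_configs:
  assumes V: "finite V"
  shows "(\<And>x. x \<notin> V \<Longrightarrow> f x = 0) \<Longrightarrow> sum f V = 2 * k \<Longrightarrow>
    card (configs (V \<times> V) f k) * (\<Prod>v\<in>V. fact (f v)) = fact (2 * k)"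
proof (induction k arbitrary: f)
  case 0
  then have "f = (\<lambda>_. 0)" using V by (auto simp: fun_eq_iff)
  then show ?case by (simp add: configs_0)
next
  case (Suc k)
  let ?R = "{p. p \<in> V \<times> V \<and> 0 < f (fst p) \<and> 0 < dec f (fst p) (snd p)}"
  have "card (configs (V \<times> V) f (Suc k)) * (\<Prod>v\<in>V. fact (f v)) =
     (\<Sum>p\<in>?R. card (configs (V \<times> V) (dec (dec f (fst p)) (snd p)) k) * (\<Prod>v\<in>V. fact (f v)))"
    using V by (subst card_configs_Suc) (auto simp: sum_distrib_right)
  also have "\<dots> = (\<Sum>p\<in>?R. of_nat (f (fst p)) * of_nat (dec f (fst p) (snd p)) * fact (2 * k))"
  proof (intro sum.cong refl)
    fix p assume p: "p \<in> ?R"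
    have s: "sum f V = Suc (Suc (sum (dec (dec f (fst p)) (snd p)) V))"
      using V p by (subst sum_dec[of V "fst p"]; (subst sum_dec[of V "snd p"])?; auto)
    have IH: "card (configs (V \<times> V) (dec (dec f (fst p)) (snd p)) k) *
        (\<Prod>v\<in>V. fact (dec (dec f (fst p)) (snd p) v)) = fact (2 * k)"
      using Suc.prems s by (intro Suc.IH) (auto simp: dec_def)
    have F: "(\<Prod>v\<in>V. fact (f v)) = f (fst p) * (dec f (fst p) (snd p) *
        (\<Prod>v\<in>V. fact (dec (dec f (fst p)) (snd p) v)))"
      using V p by (subst prod_fact_dec[of V "fst p"]; (subst prod_fact_dec[of V "snd p"])?; auto)
    show "card (configs (V \<times> V) (dec (dec f (fst p)) (snd p)) k) * (\<Prod>v\<in>V. fact (f v)) =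
        of_nat (f (fst p)) * of_nat (dec f (fst p) (snd p)) * fact (2 * k)"
      unfolding F IH[symmetric] by (simp only: of_nat_id mult_ac)
  qed
  also have "\<dots> = (\<Sum>p\<in>V \<times> V. of_nat (f (fst p)) * of_nat (dec f (fst p) (snd p)) * fact (2 * k))"
    using V by (intro sum_restrict_nonzero) simp
  also have "\<dots> = (\<Sum>u\<in>V. f u * (\<Sum>v\<in>V. dec f u v) * fact (2 * k))"
    by (simp add: sum.cartesian_product' sum_distrib_left sum_distrib_right mult.assoc)
  also have "\<dots> = (\<Sum>u\<in>V. f u * (2 * k + 1) * fact (2 * k))"
  proof (intro sum.cong refl)
    fix u assume "u \<in> V"
    then show "f u * (\<Sum>v\<in>V. dec f u v) * fact (2 * k) = f u * (2 * k + 1) * fact (2 * k)"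
      using sum_dec[of V u f] V Suc.prems(2) by (cases "f u = 0") auto
  qed
  also have "\<dots> = sum f V * ((2 * k + 1) * fact (2 * k))"
    by (simp only: sum_distrib_right mult.assoc)
  also have "\<dots> = fact (2 * Suc k)"
    using Suc.prems(2) by (simp add: algebra_simps)
  finally show ?case .
qed

lemma sum_over_types:
  assumes "finite V" "finite T" "\<tau> ` V \<subseteq> T"
  shows "(\<Sum>v\<in>V. f v * h (\<tau> v) :: 'b::comm_semiring_1) = (\<Sum>t\<in>T. (\<Sum>v | v \<in> V \<and> \<tau> v = t. f v) * h t)"
proof -
  have "(\<Sum>v\<in>V. f v * h (\<tau> v)) = (\<Sum>t\<in>T. \<Sum>v | v \<in> V \<and> \<tau> v = t. f v * h (\<tau> v))"
    using assms by (intro sum.group[symmetric]) auto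
  also have "\<dots> = (\<Sum>t\<in>T. (\<Sum>v | v \<in> V \<and> \<tau> v = t. f v) * h t)"
    by (intro sum.cong) (auto simp: sum_distrib_right)
  finally show ?thesis .
qed

text \<open>Using up a half-edge of \<open>u\<close> lowers the total degree of its class by one, so
  the recursion on vertex degrees descends to class degrees.\<close>

lemma type_sum_dec:
  assumes "finite V" "u \<in> V" "0 < f u"
  shows "(\<lambda>t. \<Sum>v | v \<in> V \<and> \<tau> v = t. dec f u v) = dec (\<lambda>t. \<Sum>v | v \<in> V \<and> \<tau> v = t. f v) (\<tau> u)"
    "0 < (\<Sum>v | v \<in> V \<and> \<tau> v = \<tau> u. f v)"
proof -
  have "(\<Sum>v | v \<in> V \<and> \<tau> v = \<tau> u. f v) = Suc (\<Sum>v | v \<in> V \<and> \<tau> v = \<tau> u. dec f u v)"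
    using assms by (intro sum_dec) auto
  moreover have "(\<Sum>v | v \<in> V \<and> \<tau> v = t. dec f u v) = (\<Sum>v | v \<in> V \<and> \<tau> v = t. f v)" if "t \<noteq> \<tau> u" for t
    using that by (intro sum.cong) (auto simp: dec_def)
  ultimately show "(\<lambda>t. \<Sum>v | v \<in> V \<and> \<tau> v = t. dec f u v) = dec (\<lambda>t. \<Sum>v | v \<in> V \<and> \<tau> v = t. f v) (\<tau> u)"
    "0 < (\<Sum>v | v \<in> V \<and> \<tau> v = \<tau> u. f v)"
    by (auto simp: fun_eq_iff dec_def)
qed

text \<open>The number of lists is a coefficient of a generating function with one variable \<open>y t\<close> per class, and is bounded by its value.\<close>

lemma card_configs_types_le:
  fixes y :: "'t \<Rightarrow> real"
  assumes V: "finite V" and T: "finite T" "\<tau> ` V \<subseteq> T" and R: "R \<subseteq> V \<times> V"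
    and rel: "\<And>u v. (u, v) \<in> R \<Longrightarrow> (\<tau> u, \<tau> v) \<in> M" and M: "M \<subseteq> T \<times> T"
    and y: "\<And>t. t \<in> T \<Longrightarrow> 0 \<le> y t"
  shows "real (card (configs R f k)) * (\<Prod>v\<in>V. fact (f v)) * (\<Prod>t\<in>T. y t ^ (\<Sum>v | v \<in> V \<and> \<tau> v = t. f v))
    \<le> (\<Prod>t\<in>T. fact (\<Sum>v | v \<in> V \<and> \<tau> v = t. f v)) * (\<Sum>p\<in>M. y (fst p) * y (snd p)) ^ k"
proof (induction k arbitrary: f)
  case 0
  then show ?case by (auto simp: configs_0 intro!: prod_nonneg)
next
  case (Suc k)
  let ?n = "\<lambda>f t. \<Sum>v | v \<in> V \<and> \<tau> v = t. f v"
  let ?Q = "\<Sum>p\<in>M. y (fst p) * y (snd p)"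
  let ?R = "{p. p \<in> R \<and> 0 < f (fst p) \<and> 0 < dec f (fst p) (snd p)}"
  define n where "n = ?n f"
  define Y where "Y = (\<Prod>t\<in>T. y t ^ n t)"
  \<comment> \<open>The bound for the lists that follow a first pair with classes \<open>s\<close>
    and \<open>t\<close>. It depends on that pair only through the classes, so sums over vertices
    collapse to sums over classes.\<close>
  define H where "H s t = of_bool ((s, t) \<in> M) * (y s * y t * ((\<Prod>r\<in>T. fact (dec (dec n s) t r)) * ?Q ^ k))" for s t
  have finR: "finite R" using R V by (auto intro: finite_subset)
  have finM: "finite M" using M T by (auto intro: finite_subset)
  have Hnn: "0 \<le> H s t" for s t
    unfolding H_def using y M by (auto intro!: mult_nonneg_nonneg prod_nonneg sum_nonneg zero_le_power simp: of_bool_def)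
  have "real (card (configs R f (Suc k))) * (\<Prod>v\<in>V. fact (f v)) * Y =
     (\<Sum>p\<in>?R. real (card (configs R (dec (dec f (fst p)) (snd p)) k)) * (\<Prod>v\<in>V. fact (f v)) * Y)"
    using finR by (subst card_configs_Suc) (auto simp: sum_distrib_right)
  also have "\<dots> \<le> (\<Sum>p\<in>?R. real (f (fst p)) * real (dec f (fst p) (snd p)) * H (\<tau> (fst p)) (\<tau> (snd p)))"
  proof (intro sum_mono)
    fix p assume p: "p \<in> ?R"
    obtain u v where uv: "p = (u, v)" by (cases p)
    have uvV: "u \<in> V" "v \<in> V" "0 < f u" "0 < dec f u v" "\<tau> u \<in> T" "\<tau> v \<in> T" "(\<tau> u, \<tau> v) \<in> M"
      using p R T uv rel by auto
    let ?f = "dec (dec f u) v"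
    have nn: "?n ?f = dec (dec n (\<tau> u)) (\<tau> v)" "0 < n (\<tau> u)" "0 < dec n (\<tau> u) (\<tau> v)"
      using type_sum_dec[of V u f \<tau>] type_sum_dec[of V v "dec f u" \<tau>] V uvV
      unfolding n_def by (auto simp: fun_eq_iff)
    have F: "(\<Prod>v\<in>V. fact (f v)) = real (f u) * (real (dec f u v) * (\<Prod>v\<in>V. fact (?f v)))"
      using V uvV by (subst prod_fact_dec[of V u]; (subst prod_fact_dec[of V v])?; auto)
    have Y: "Y = y (\<tau> u) * (y (\<tau> v) * (\<Prod>t\<in>T. y t ^ ?n ?f t))"
      unfolding Y_def nn(1)[unfolded fun_eq_iff, rule_format] using T uvV nn(2,3)
      by (subst prod_power_dec[of T "\<tau> u"]; (subst prod_power_dec[of T "\<tau> v"])?; auto)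
    have "real (card (configs R ?f k)) * (\<Prod>v\<in>V. fact (f v)) * Y =
       (f u * dec f u v * y (\<tau> u) * y (\<tau> v)) *
       (real (card (configs R ?f k)) * (\<Prod>v\<in>V. fact (?f v)) * (\<Prod>t\<in>T. y t ^ ?n ?f t))"
      unfolding F Y by (simp add: mult_ac)
    also have "\<dots> \<le> (f u * dec f u v * y (\<tau> u) * y (\<tau> v)) * ((\<Prod>t\<in>T. fact (?n ?f t)) * ?Q ^ k)"
      using y uvV by (intro mult_left_mono Suc.IH) auto
    also have "\<dots> = f u * dec f u v * H (\<tau> u) (\<tau> v)"
      using uvV nn(1) unfolding H_def by (simp add: mult_ac fun_eq_iff)
    finally show "real (card (configs R (dec (dec f (fst p)) (snd p)) k)) * (\<Prod>v\<in>V. fact (f v)) * Y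
       \<le> real (f (fst p)) * real (dec f (fst p) (snd p)) * H (\<tau> (fst p)) (\<tau> (snd p))"
      by (simp add: uv)
  qed
  also have "\<dots> = (\<Sum>p\<in>R. real (f (fst p)) * real (dec f (fst p) (snd p)) * H (\<tau> (fst p)) (\<tau> (snd p)))"
    using finR by (rule sum_restrict_nonzero)
  \<comment> \<open>Enlarging \<open>R\<close> to \<open>V \<times> V\<close> makes the sum
    factorise. The added terms are nonnegative, and those whose classes are not related by
    \<open>M\<close> are zero because of the indicator in \<open>H\<close>.\<close>
  also have "\<dots> \<le> (\<Sum>p\<in>V\<times>V. real (f (fst p)) * real (dec f (fst p) (snd p)) * H (\<tau> (fst p)) (\<tau> (snd p)))"
    using V R Hnn by (intro sum_mono2) auto
  also have "\<dots> = (\<Sum>u\<in>V. real (f u) * (\<Sum>v\<in>V. real (dec f u v) * H (\<tau> u) (\<tau> v)))"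
    by (simp add: sum.cartesian_product' sum_distrib_left mult.assoc)
  also have "\<dots> = (\<Sum>u\<in>V. real (f u) * (\<Sum>t\<in>T. real (dec n (\<tau> u) t) * H (\<tau> u) t))"
  proof (intro sum.cong refl)
    fix u assume u: "u \<in> V"
    show "real (f u) * (\<Sum>v\<in>V. real (dec f u v) * H (\<tau> u) (\<tau> v)) =
          real (f u) * (\<Sum>t\<in>T. real (dec n (\<tau> u) t) * H (\<tau> u) t)"
    proof (cases "f u = 0")
      case False
      have "(\<Sum>v\<in>V. real (dec f u v) * H (\<tau> u) (\<tau> v)) = (\<Sum>t\<in>T. (\<Sum>v | v \<in> V \<and> \<tau> v = t. real (dec f u v)) * H (\<tau> u) t)"
        using V T by (rule sum_over_types)
      also have "\<dots> = (\<Sum>t\<in>T. real (?n (dec f u) t) * H (\<tau> u) t)" by simp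
      also have "?n (dec f u) = dec n (\<tau> u)"
        unfolding n_def using V u False by (intro type_sum_dec) auto
      finally show ?thesis by simp
    qed simp
  qed
  also have "\<dots> = (\<Sum>s\<in>T. real (n s) * (\<Sum>t\<in>T. real (dec n s t) * H s t))"
    using sum_over_types[OF V T, of "\<lambda>u. real (f u)" "\<lambda>s. \<Sum>t\<in>T. real (dec n s t) * H s t"]
    by (simp add: n_def)
  also have "\<dots> = (\<Sum>p\<in>T\<times>T. real (n (fst p)) * real (dec n (fst p) (snd p)) * H (fst p) (snd p))"
    by (simp add: sum.cartesian_product' sum_distrib_left mult.assoc)
  also have "\<dots> \<le> (\<Sum>p\<in>T\<times>T. of_bool (p \<in> M) * (y (fst p) * y (snd p) * ((\<Prod>r\<in>T. fact (n r)) * ?Q ^ k)))"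
  proof (intro sum_mono)
    fix p assume p: "p \<in> T \<times> T"
    obtain s t where st: "p = (s, t)" by (cases p)
    have sT: "s \<in> T" "t \<in> T" using p st by auto
    have "n s * dec n s t * (\<Prod>r\<in>T. fact (dec (dec n s) t r)) \<le> (\<Prod>r\<in>T. fact (n r) :: real)"
    proof (cases "0 < n s \<and> 0 < dec n s t")
      case True
      then have "(\<Prod>r\<in>T. fact (n r) :: real) = n s * (dec n s t * (\<Prod>r\<in>T. fact (dec (dec n s) t r)))"
        using T sT by (subst prod_fact_dec[of T s]; (subst prod_fact_dec[of T t])?; auto)
      then show ?thesis by simp
    qed (auto intro!: prod_nonneg)
    then have "of_bool (p \<in> M) * (y s * y t * ?Q ^ k) * (n s * dec n s t * (\<Prod>r\<in>T. fact (dec (dec n s) t r)))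
       \<le> of_bool (p \<in> M) * (y s * y t * ?Q ^ k) * (\<Prod>r\<in>T. fact (n r))"
      using y sT M by (intro mult_left_mono) (auto intro!: mult_nonneg_nonneg sum_nonneg zero_le_power)
    then show "real (n (fst p)) * real (dec n (fst p) (snd p)) * H (fst p) (snd p) \<le>
       of_bool (p \<in> M) * (y (fst p) * y (snd p) * ((\<Prod>r\<in>T. fact (n r)) * ?Q ^ k))"
      unfolding H_def st by (simp add: mult_ac)
  qed
  also have "\<dots> = (\<Sum>p\<in>M. y (fst p) * y (snd p) * ((\<Prod>r\<in>T. fact (n r)) * ?Q ^ k))"
    using M T by (intro sum.mono_neutral_cong_right) auto
  also have "\<dots> = ?Q * ((\<Prod>r\<in>T. fact (n r)) * ?Q ^ k)"
    by (simp only: sum_distrib_right)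
  also have "\<dots> = (\<Prod>r\<in>T. fact (n r)) * ?Q ^ Suc k"
    by (simp add: mult_ac)
  finally show ?case by (simp add: n_def Y_def)
qed

section \<open>Simple configurations and regular graphs\<close>

abbreviation edge :: "'a \<times> 'a \<Rightarrow> 'a set" where
  "edge p \<equiv> {fst p, snd p}"

definition simple_config :: "('a \<times> 'a) list \<Rightarrow> bool" where
  "simple_config ps \<longleftrightarrow> distinct (map edge ps) \<and> (\<forall>p\<in>set ps. fst p \<noteq> snd p)"

lemma card_edge_fibre:
  assumes "card e = 2"
  shows "finite {p. edge p = e}" "card {p. edge p = e} = 2"
proof -
  obtain x y where xy: "e = {x, y}" "x \<noteq> y" using assms by (auto simp: card_2_iff)
  have "{p. edge p = e} = {(x, y), (y, x)}"
    using xy by (auto simp: doubleton_eq_iff)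
  with xy show "finite {p. edge p = e}" "card {p. edge p = e} = 2" by simp_all
qed

text \<open>The edges may be listed in any order, and each in either of two orientations.\<close>

lemma card_edge_enumerations:
  assumes "finite E" "\<And>e. e \<in> E \<Longrightarrow> card e = 2"
  shows "finite {ps. simple_config ps \<and> edge ` set ps = E} \<and>
    card {ps. simple_config ps \<and> edge ` set ps = E} = fact (card E) * 2 ^ card E"
  using assms
proof (induction "card E" arbitrary: E)
  case 0
  then have "{ps. simple_config ps \<and> edge ` set ps = E} = {[]}" by (auto simp: simple_config_def)
  with 0 show ?case by auto
next
  case (Suc m)
  let ?F = "\<lambda>E. {ps. simple_config ps \<and> edge ` set ps = E}"
  let ?P = "{p. edge p \<in> E}"
  have ne: "fst p \<noteq> snd p" if "p \<in> ?P" for p using Suc.prems(2)[of "edge p"] that by auto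
  have decomp: "?F E = (\<Union>p\<in>?P. (#) p ` ?F (E - {edge p}))"
  proof (intro equalityI subsetI)
    fix qs assume qs: "qs \<in> ?F E"
    then obtain p ps where q: "qs = p # ps" using Suc.hyps(2) by (cases qs) auto
    then have "edge p \<in> E" "ps \<in> ?F (E - {edge p})" using qs by (auto simp: simple_config_def)
    then show "qs \<in> (\<Union>p\<in>?P. (#) p ` ?F (E - {edge p}))" using q by blast
  next
    fix qs assume "qs \<in> (\<Union>p\<in>?P. (#) p ` ?F (E - {edge p}))"
    then obtain p ps where p: "p \<in> ?P" "qs = p # ps" "ps \<in> ?F (E - {edge p})" by auto
    have "edge p \<notin> edge ` set ps" using p by auto
    then show "qs \<in> ?F E" using p ne[OF p(1)] by (auto simp: simple_config_def)
  qed
  have P: "?P = (\<Union>e\<in>E. {p. edge p = e})" by auto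
  have finfib: "finite {p. edge p = e}" if "e \<in> E" for e
    using card_edge_fibre(1)[OF Suc.prems(2)[OF that]] .
  have "card ?P = (\<Sum>e\<in>E. card {p. edge p = e})"
    unfolding P using Suc.prems(1) finfib by (intro card_UN_disjoint) auto
  also have "\<dots> = 2 * Suc m" using Suc by (simp add: card_edge_fibre)
  finally have cP: "card ?P = 2 * Suc m" .
  have fP: "finite ?P" unfolding P using Suc.prems(1) finfib by auto
  have IH: "finite (?F (E - {edge p}))" "card (?F (E - {edge p})) = fact m * 2 ^ m" if "p \<in> ?P" for p
    using Suc.hyps(1)[of "E - {edge p}"] Suc.hyps(2)[symmetric] Suc.prems that by auto
  have "card (?F E) = (\<Sum>p\<in>?P. card ((#) p ` ?F (E - {edge p})))"
    unfolding decomp using fP IH by (intro card_UN_disjoint) auto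
  also have "\<dots> = (\<Sum>p\<in>?P. fact m * 2 ^ m)"
    using IH by (intro sum.cong) (auto simp: card_image)
  also have "\<dots> = fact (Suc m) * 2 ^ Suc m" using cP by (simp add: algebra_simps)
  finally have "card (?F E) = fact (card E) * 2 ^ card E" using Suc.hyps(2) by simp
  moreover have "finite (?F E)" unfolding decomp using fP IH by auto
  ultimately show ?case by blast
qed

lemma deg_simple_config:
  "simple_config ps \<Longrightarrow> card {e \<in> edge ` set ps. v \<in> e} = deg ps v"
proof (induction ps)
  case (Cons p ps)
  then have s: "simple_config ps" "edge p \<notin> edge ` set ps" "fst p \<noteq> snd p"
    by (auto simp: simple_config_def)
  let ?A = "{e \<in> edge ` set ps. v \<in> e}"
  have A: "edge p \<notin> ?A" "finite ?A" "card ?A = deg ps v"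
    using s Cons.IH by auto
  show ?case
  proof (cases "v = fst p \<or> v = snd p")
    case True
    then have "{e \<in> edge ` set (p # ps). v \<in> e} = insert (edge p) ?A" by auto
    then have "card {e \<in> edge ` set (p # ps). v \<in> e} = Suc (card ?A)"
      using A by (simp only: card_insert_disjoint not_False_eq_True)
    then show ?thesis using A True s(3) by auto
  next
    case False
    then have "{e \<in> edge ` set (p # ps). v \<in> e} = ?A" by auto
    then show ?thesis using A False by simp
  qed
qed simp

definition reg_configs :: "nat \<Rightarrow> nat \<Rightarrow> (nat \<times> nat) list set" where
  "reg_configs N d = configs ({..<N} \<times> {..<N}) (\<lambda>v. if v < N then d else 0) (d * N div 2)"

definition config_graph :: "nat \<Rightarrow> (nat \<times> nat) list \<Rightarrow> nat graph" where
  "config_graph N ps = Graph {..<N} (edge ` set ps)"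

lemma finite_reg_configs [simp]: "finite (reg_configs N d)"
  by (simp add: reg_configs_def)

lemma finite_regular_graphs [simp]: "finite (regular_graphs N d)"
proof (rule finite_subset)
  show "regular_graphs N d \<subseteq> Graph {..<N} ` Pow (Pow {..<N})"
  proof
    fix G assume "G \<in> regular_graphs N d"
    then show "G \<in> Graph {..<N} ` Pow (Pow {..<N})"
      by (cases G) (auto simp: regular_graphs_def simple_graph_def)
  qed
qed simp

lemma config_graph_regular:
  assumes "ps \<in> reg_configs N d" "simple_config ps"
  shows "config_graph N ps \<in> regular_graphs N d"
  using assms deg_simple_config[OF assms(2)]
  by (auto simp: config_graph_def regular_graphs_def simple_graph_def vertex_degree_def
      reg_configs_def configs_def simple_config_def)

lemma config_of_regular:
  assumes G: "G \<in> regular_graphs N d" and ps: "simple_config ps" "edge ` set ps = edges G"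
  shows "ps \<in> reg_configs N d" "config_graph N ps = G" "length ps = card (edges G)"
proof -
  have sub: "e \<subseteq> {..<N}" if "e \<in> edges G" for e
    using G that by (auto simp: regular_graphs_def simple_graph_def)
  have V: "verts G = {..<N}" using G by (auto simp: regular_graphs_def)
  have set: "set ps \<subseteq> {..<N} \<times> {..<N}"
  proof
    fix p assume "p \<in> set ps"
    then have "edge p \<subseteq> {..<N}" using sub ps(2) by blast
    then show "p \<in> {..<N} \<times> {..<N}" by (cases p) auto
  qed
  have deg: "deg ps v = (if v < N then d else 0)" for v
  proof (cases "v < N")
    case True
    then show ?thesis using G deg_simple_config[OF ps(1), of v] V ps(2)
      by (auto simp: regular_graphs_def vertex_degree_def)
  next
    case False
    then have "{e \<in> edges G. v \<in> e} = {}" using sub by blast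
    then have "card {e \<in> edges G. v \<in> e} = 0" by (simp only: card.empty)
    then show ?thesis using False deg_simple_config[OF ps(1), of v] ps(2) by simp
  qed
  have "2 * length ps = sum (deg ps) {..<N}" using set by (simp add: sum_deg)
  also have "\<dots> = N * d" by (simp add: deg)
  finally have len: "length ps = d * N div 2" using arg_cong[of "2 * length ps" "N * d" "\<lambda>x. x div 2"]
    by (simp add: mult.commute)
  show "ps \<in> reg_configs N d" using set len deg by (auto simp: reg_configs_def configs_def)
  show "config_graph N ps = G" using V ps(2) by (cases G) (auto simp: config_graph_def)
  have "distinct (map edge ps)" using ps(1) by (simp add: simple_config_def)
  from distinct_card[OF this] ps(2) show "length ps = card (edges G)" by simp
qed

text \<open>Every regular graph has the same number of codes, so proportions among regular graphs
  equal proportions among simple configurations.\<close>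

lemma card_regular_graphs_configs:
  assumes "P \<subseteq> regular_graphs N d"
  shows "card {ps \<in> reg_configs N d. simple_config ps \<and> config_graph N ps \<in> P} =
    card P * (fact (d * N div 2) * 2 ^ (d * N div 2))"
proof -
  let ?F = "\<lambda>G. {ps. simple_config ps \<and> edge ` set ps = edges G}"
  have finP: "finite P" using assms finite_subset by fastforce
  have fib: "finite (?F G)" "card (?F G) = fact (d * N div 2) * 2 ^ (d * N div 2)" if "G \<in> P" for G
  proof -
    have G: "G \<in> regular_graphs N d" using that assms by auto
    have fin: "finite (edges G)"
      using G by (intro finite_subset[of "edges G" "Pow {..<N}"]) (auto simp: regular_graphs_def simple_graph_def)
    have "card e = 2" if "e \<in> edges G" for e using G that by (auto simp: regular_graphs_def simple_graph_def)
    note en = card_edge_enumerations[OF fin this]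
    then have "card (?F G) \<noteq> 0" by simp
    then have "?F G \<noteq> {}" by (intro notI) (simp only: card.empty)
    then obtain ps where "ps \<in> ?F G" by blast
    then have "card (edges G) = d * N div 2"
      using config_of_regular[OF G, of ps] by (auto simp: reg_configs_def configs_def)
    with en show "finite (?F G)" "card (?F G) = fact (d * N div 2) * 2 ^ (d * N div 2)" by simp_all
  qed
  have "{ps \<in> reg_configs N d. simple_config ps \<and> config_graph N ps \<in> P} = (\<Union>G\<in>P. ?F G)"
  proof (intro equalityI subsetI)
    fix ps assume "ps \<in> (\<Union>G\<in>P. ?F G)"
    then obtain G where G: "G \<in> P" "simple_config ps" "edge ` set ps = edges G" by auto
    then have "G \<in> regular_graphs N d" using assms by auto
    from config_of_regular(1,2)[OF this G(2,3)] G
    show "ps \<in> {ps \<in> reg_configs N d. simple_config ps \<and> config_graph N ps \<in> P}" by simp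
  next
    fix ps assume "ps \<in> {ps \<in> reg_configs N d. simple_config ps \<and> config_graph N ps \<in> P}"
    then show "ps \<in> (\<Union>G\<in>P. ?F G)" by (intro UN_I[of "config_graph N ps"]) (simp_all add: config_graph_def)
  qed
  also have "card \<dots> = (\<Sum>G\<in>P. card (?F G))"
  proof (rule card_UN_disjoint)
    show "\<forall>G\<in>P. \<forall>H\<in>P. G \<noteq> H \<longrightarrow> ?F G \<inter> ?F H = {}"
    proof (intro ballI impI)
      fix G H assume GH: "G \<in> P" "H \<in> P" "G \<noteq> H"
      then have "G \<in> regular_graphs N d" "H \<in> regular_graphs N d" using assms by auto
      then have "verts G = verts H" by (simp add: regular_graphs_def)
      then have "edges G \<noteq> edges H" using GH(3) by (cases G; cases H) auto
      then show "?F G \<inter> ?F H = {}" by auto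
    qed
  qed (use finP fib in auto)
  also have "\<dots> = card P * (fact (d * N div 2) * 2 ^ (d * N div 2))"
    using fib by simp
  finally show ?thesis .
qed

section \<open>Switchings\<close>

definition nonloop_edges :: "('a \<times> 'a) list \<Rightarrow> 'a set set" where
  "nonloop_edges ps = (\<lambda>i. edge (ps ! i)) ` {i. i < length ps \<and> fst (ps ! i) \<noteq> snd (ps ! i)}"

text \<open>Truncated subtraction is harmless here: there are never more edges than pairs.\<close>

definition defect :: "('a \<times> 'a) list \<Rightarrow> nat" where
  "defect ps = length ps - card (nonloop_edges ps)"

lemma finite_nonloop_edges [simp]: "finite (nonloop_edges ps)"
  by (simp add: nonloop_edges_def)

lemma nonloop_edgesI:
  "i < length ps \<Longrightarrow> fst (ps ! i) \<noteq> snd (ps ! i) \<Longrightarrow> edge (ps ! i) \<in> nonloop_edges ps"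
  by (auto simp: nonloop_edges_def)

lemma defect_zero_simple:
  assumes "defect ps = 0"
  shows "simple_config ps"
proof -
  let ?I = "{i. i < length ps \<and> fst (ps ! i) \<noteq> snd (ps ! i)}"
  have c: "length ps \<le> card (nonloop_edges ps)" using assms by (simp add: defect_def)
  have ci: "card (nonloop_edges ps) \<le> card ?I"
    unfolding nonloop_edges_def by (rule card_image_le) simp
  have cl: "card ?I \<le> card {..<length ps}" by (intro card_mono) auto
  have eq: "?I = {..<length ps}" using c ci cl by (intro card_subset_eq) auto
  have "inj_on (\<lambda>i. edge (ps ! i)) ?I"
    \<comment> \<open>With defect zero, equality holds throughout in edges, non-loop positions, all
      positions; the first equality makes the edges distinct.\<close>
    using c ci cl unfolding nonloop_edges_def by (intro eq_card_imp_inj_on) auto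
  then have "distinct (map edge ps)"
    unfolding eq by (auto simp: distinct_conv_nth inj_on_def)
  moreover have "fst p \<noteq> snd p" if "p \<in> set ps" for p
    using eq that unfolding in_set_conv_nth by blast
  ultimately show ?thesis unfolding simple_config_def by blast
qed

text \<open>Position \<open>i\<close> holds a loop or a repeated edge: it can be overwritten without
  losing an edge.\<close>

lemma defect_pos_redundant:
  assumes "defect ps > 0"
  obtains i where "i < length ps"
    "fst (ps ! i) \<noteq> snd (ps ! i) \<Longrightarrow> \<exists>l<length ps. l \<noteq> i \<and> edge (ps ! l) = edge (ps ! i)"
proof -
  have "\<exists>i<length ps. fst (ps ! i) \<noteq> snd (ps ! i) \<longrightarrow>
      (\<exists>l<length ps. l \<noteq> i \<and> edge (ps ! l) = edge (ps ! i))"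
  proof (rule ccontr)
    assume no: "\<not> ?thesis"
    then have I: "{i. i < length ps \<and> fst (ps ! i) \<noteq> snd (ps ! i)} = {..<length ps}" by blast
    have "inj_on (\<lambda>i. edge (ps ! i)) {..<length ps}" using no unfolding inj_on_def by blast
    then have "card (nonloop_edges ps) = length ps"
      unfolding nonloop_edges_def I by (subst card_image) auto
    with assms show False by (simp add: defect_def)
  qed
  then show thesis using that by blast
qed

text \<open>Exchanging second entries preserves all degrees and is an involution, so the preimages
  of a list are found among its own switchings.\<close>

definition switch :: "nat \<Rightarrow> nat \<Rightarrow> ('a \<times> 'a) list \<Rightarrow> ('a \<times> 'a) list" where
  "switch i j ps = ps[i := (fst (ps ! i), snd (ps ! j)), j := (fst (ps ! j), snd (ps ! i))]"

lemma length_switch [simp]: "length (switch i j ps) = length ps"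
  by (simp add: switch_def)

lemma switch_switch: "i < length ps \<Longrightarrow> j < length ps \<Longrightarrow> switch i j (switch i j ps) = ps"
  by (cases "i = j") (auto simp: switch_def list_eq_iff_nth_eq nth_list_update)

lemma deg_conv_card:
  "deg ps x = card {i. i < length ps \<and> fst (ps ! i) = x} + card {i. i < length ps \<and> snd (ps ! i) = x}"
proof -
  have "deg ps x = length (filter (\<lambda>p. fst p = x) ps) + length (filter (\<lambda>p. snd p = x) ps)"
    by (induction ps) auto
  then show ?thesis by (simp add: length_filter_conv_card)
qed

lemma switch_in_configs:
  assumes "ps \<in> configs (V \<times> V) f k" "i < k" "j < k"
  shows "switch i j ps \<in> configs (V \<times> V) f k"
proof (cases "i = j")
  case True
  then show ?thesis using assms by (simp add: switch_def)
next
  case False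
  let ?qs = "switch i j ps"
  have len: "length ps = k" and set: "set ps \<subseteq> V \<times> V" and deg: "deg ps = f"
    using assms by (auto simp: configs_def)
  have V: "fst (ps ! l) \<in> V" "snd (ps ! l) \<in> V" if "l < k" for l
    using subsetD[OF set nth_mem, of l] len that by (simp_all add: mem_Times_iff)
  have nth: "?qs ! l = (fst (ps ! l), snd (ps ! (if l = i then j else if l = j then i else l)))" if "l < k" for l
    using that False len assms by (auto simp: switch_def nth_list_update)
  have "set ?qs \<subseteq> V \<times> V"
    using V len assms nth by (auto simp: in_set_conv_nth)
  moreover have "deg ?qs x = deg ps x" for x
  proof -
    let ?t = "\<lambda>l. if l = i then j else if l = j then i else l"
    have "bij_betw ?t {l. l < k \<and> snd (?qs ! l) = x} {l. l < k \<and> snd (ps ! l) = x}"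
      using nth assms by (intro bij_betw_byWitness[where f' = ?t]) auto
    moreover have "{l. l < k \<and> fst (?qs ! l) = x} = {l. l < k \<and> fst (ps ! l) = x}" using nth by auto
    ultimately show ?thesis unfolding deg_conv_card length_switch len
      by (simp only: bij_betw_same_card)
  qed
  ultimately show ?thesis using len deg by (auto simp: configs_def)
qed

lemma card_indices_le:
  assumes "\<And>x. deg ps x \<le> D" "finite X"
  shows "card {i. i < length ps \<and> snd (ps ! i) \<in> X} \<le> D * card X"
    "card {i. i < length ps \<and> fst (ps ! i) \<in> X} \<le> D * card X"
proof -
  have le: "card {i. i < length ps \<and> snd (ps ! i) = x} \<le> D" for x
    using assms(1)[of x] by (simp add: deg_conv_card)
  have "{i. i < length ps \<and> snd (ps ! i) \<in> X} = (\<Union>x\<in>X. {i. i < length ps \<and> snd (ps ! i) = x})" by auto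
  then have "card {i. i < length ps \<and> snd (ps ! i) \<in> X} \<le> (\<Sum>x\<in>X. card {i. i < length ps \<and> snd (ps ! i) = x})"
    using assms by (simp add: card_UN_le)
  also have "\<dots> \<le> (\<Sum>x\<in>X. D)"
    using le by (intro sum_mono) auto
  finally show "card {i. i < length ps \<and> snd (ps ! i) \<in> X} \<le> D * card X" by (simp add: mult.commute)
next
  have le: "card {i. i < length ps \<and> fst (ps ! i) = x} \<le> D" for x
    using assms(1)[of x] by (simp add: deg_conv_card)
  have "{i. i < length ps \<and> fst (ps ! i) \<in> X} = (\<Union>x\<in>X. {i. i < length ps \<and> fst (ps ! i) = x})" by auto
  then have "card {i. i < length ps \<and> fst (ps ! i) \<in> X} \<le> (\<Sum>x\<in>X. card {i. i < length ps \<and> fst (ps ! i) = x})"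
    using assms by (simp add: card_UN_le)
  also have "\<dots> \<le> (\<Sum>x\<in>X. D)"
    using le by (intro sum_mono) auto
  finally show "card {i. i < length ps \<and> fst (ps ! i) \<in> X} \<le> D * card X" by (simp add: mult.commute)
qed

lemma card_neighbours_le:
  assumes "\<And>x. deg ps x \<le> D"
  shows "finite {y. {x, y} \<in> nonloop_edges ps} \<and> card {y. {x, y} \<in> nonloop_edges ps} \<le> D"
proof -
  let ?A = "{i. i < length ps \<and> fst (ps ! i) = x}" and ?B = "{i. i < length ps \<and> snd (ps ! i) = x}"
  have sub: "{y. {x, y} \<in> nonloop_edges ps} \<subseteq> (\<lambda>i. snd (ps ! i)) ` ?A \<union> (\<lambda>i. fst (ps ! i)) ` ?B"
    by (auto simp: nonloop_edges_def doubleton_eq_iff)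
  have "card {y. {x, y} \<in> nonloop_edges ps} \<le> card ((\<lambda>i. snd (ps ! i)) ` ?A \<union> (\<lambda>i. fst (ps ! i)) ` ?B)"
    by (rule card_mono[OF _ sub]) simp
  also have "\<dots> \<le> card ?A + card ?B"
    by (rule order.trans[OF card_Un_le]) (intro add_mono card_image_le; simp)
  also have "\<dots> \<le> D" using assms[of x] by (simp add: deg_conv_card)
  finally show ?thesis using finite_subset[OF sub] by simp
qed

text \<open>Position \<open>i\<close> is redundant, so switching it with \<open>j\<close> loses at
  most the edge at \<open>j\<close>. All but boundedly many \<open>j\<close> create two pairs that
  are new non-loop edges, which outweighs this loss.\<close>

lemma switch_reduces_defect:
  assumes deg: "\<And>x. deg ps x \<le> D" and large: "2 * (D * (D + 1)) + D < length ps" and pos: "0 < defect ps"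
  shows "\<exists>i<length ps. \<exists>j<length ps. defect (switch i j ps) < defect ps"
proof -
  let ?k = "length ps"
  let ?E = "nonloop_edges ps"
  obtain i where i: "i < ?k"
    and red: "fst (ps ! i) \<noteq> snd (ps ! i) \<Longrightarrow> \<exists>l<?k. l \<noteq> i \<and> edge (ps ! l) = edge (ps ! i)"
    using defect_pos_redundant[OF pos] by blast
  define a where "a l = fst (ps ! l)" for l
  define b where "b l = snd (ps ! l)" for l
  define Nb where "Nb x = insert x {y. {x, y} \<in> ?E}" for x
  have Nb: "finite (Nb x)" "card (Nb x) \<le> D + 1" for x
    using card_neighbours_le[OF deg, of x] unfolding Nb_def by (auto intro: order.trans[OF card_insert_le_m1])
  \<comment> \<open>The positions to avoid: \<open>?X1\<close> and \<open>?X2\<close> would make a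
    new pair a loop or an existing edge. \<open>?X3\<close> contains \<open>i\<close> itself and,
    when removed, ensures that the two new edges coincide only if both positions hold loops.\<close>
  let ?X1 = "{l. l < ?k \<and> b l \<in> Nb (a i)}" and ?X2 = "{l. l < ?k \<and> a l \<in> Nb (b i)}"
    and ?X3 = "{l. l < ?k \<and> a l \<in> {a i}}"
  have "card (?X1 \<union> ?X2 \<union> ?X3) \<le> card ?X1 + card ?X2 + card ?X3"
    by (intro order.trans[OF card_Un_le] add_mono order_refl card_Un_le)
  also have "\<dots> \<le> D * (D + 1) + D * (D + 1) + D * 1"
  proof (intro add_mono)
    show "card ?X1 \<le> D * (D + 1)" "card ?X2 \<le> D * (D + 1)"
      unfolding a_def b_def
      by (rule order.trans[OF card_indices_le(1)[OF deg Nb(1)] mult_le_mono2[OF Nb(2)]],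
          rule order.trans[OF card_indices_le(2)[OF deg Nb(1)] mult_le_mono2[OF Nb(2)]])
    show "card ?X3 \<le> D * 1"
      unfolding a_def using card_indices_le(2)[OF deg, of "{fst (ps ! i)}"] by simp
  qed
  also have "\<dots> < ?k" using large by simp
  finally have "card (?X1 \<union> ?X2 \<union> ?X3) < card {..<?k}" by simp
  then have "\<not> {..<?k} \<subseteq> ?X1 \<union> ?X2 \<union> ?X3"
    using card_mono[of "?X1 \<union> ?X2 \<union> ?X3" "{..<?k}"] by auto
  then obtain j where j: "j < ?k" "b j \<notin> Nb (a i)" "a j \<notin> Nb (b i)" "a j \<noteq> a i" by auto
  have ij: "i \<noteq> j" using j by auto
  define qs where "qs = switch i j ps"
  have qi: "qs ! i = (a i, b j)" "qs ! j = (a j, b i)"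
    using i j ij by (auto simp: qs_def switch_def a_def b_def nth_list_update)
  have ql: "qs ! l = ps ! l" if "l \<noteq> i" "l \<noteq> j" for l
    using that by (simp add: qs_def switch_def)
  have lq: "length qs = ?k" by (simp add: qs_def)
  have n1: "{a i, b j} \<notin> ?E" "a i \<noteq> b j" and n2: "{a j, b i} \<notin> ?E" "a j \<noteq> b i"
    using j by (auto simp: Nb_def insert_commute)
  have new: "{a i, b j} \<in> nonloop_edges qs" "{a j, b i} \<in> nonloop_edges qs"
    using nonloop_edgesI[of i qs] nonloop_edgesI[of j qs] i j qi lq n1(2) n2(2) by simp_all
  have keep: "e \<in> nonloop_edges qs" if e: "e \<in> ?E" "a j \<noteq> b j \<Longrightarrow> e \<noteq> {a j, b j}" for e
  proof -
    obtain l where l: "l < ?k" "a l \<noteq> b l" "e = {a l, b l}"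
      using e(1) by (auto simp: nonloop_edges_def a_def b_def)
    obtain m where m: "m < ?k" "m \<noteq> i" "e = {a m, b m}"
      using l red by (cases "l = i") (auto simp: a_def b_def)
    have nl: "a m \<noteq> b m" using m l by auto
    then have "m \<noteq> j" using e(2) m by auto
    then have "qs ! m = ps ! m" using ql m by simp
    then show ?thesis using nonloop_edgesI[of m qs] m nl lq by (simp add: a_def b_def)
  qed
  have "card ?E < card (nonloop_edges qs)"
  proof (cases "{a i, b j} = {a j, b i}")
    case True
    \<comment> \<open>Coinciding new edges amount to a single gain, but position \<open>j\<close>
      then holds a loop and nothing is lost.\<close>
    then have "a j = b j" using j(4) by (auto simp: doubleton_eq_iff)
    then have "insert {a i, b j} ?E \<subseteq> nonloop_edges qs" using keep new by auto
    then have "card (insert {a i, b j} ?E) \<le> card (nonloop_edges qs)" by (intro card_mono) auto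
    then show ?thesis using n1 by simp
  next
    case False
    have "insert {a i, b j} (insert {a j, b i} (?E - {{a j, b j}})) \<subseteq> nonloop_edges qs"
      using keep new by auto
    then have "card (insert {a i, b j} (insert {a j, b i} (?E - {{a j, b j}}))) \<le> card (nonloop_edges qs)"
      by (intro card_mono) auto
    moreover have "card ?E \<le> Suc (card (?E - {{a j, b j}}))"
      by (cases "{a j, b j} \<in> ?E") (simp_all add: card_Suc_Diff1 del: card_Diff_insert)
    ultimately show ?thesis using n1 n2 False by simp
  qed
  moreover have "card (nonloop_edges qs) \<le> length qs"
    unfolding nonloop_edges_def
    by (rule order.trans[OF card_image_le]) (auto intro: order.trans[OF card_mono[of "{..<length qs}"]])
  ultimately have "defect qs < defect ps" unfolding defect_def lq by linarith
  then show ?thesis using i j qs_def by blast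
qed

lemma card_defect_Suc_le:
  assumes V: "finite V" and f: "\<And>x. f x \<le> D" and large: "2 * (D * (D + 1)) + D < k"
  shows "card {ps \<in> configs (V \<times> V) f k. defect ps \<le> Suc b} \<le> k\<^sup>2 * card {ps \<in> configs (V \<times> V) f k. defect ps \<le> b}"
proof -
  let ?S = "\<lambda>b. {ps \<in> configs (V \<times> V) f k. defect ps \<le> b}"
  have "?S (Suc b) \<subseteq> (\<lambda>((i, j), ps). switch i j ps) ` (({..<k} \<times> {..<k}) \<times> ?S b)"
  proof
    fix ps assume ps: "ps \<in> ?S (Suc b)"
    then have len: "length ps = k" and d: "deg ps = f" by (auto simp: configs_def)
    obtain i j where ij: "i < k" "j < k" "defect (switch i j ps) \<le> b"
    proof (cases "defect ps = 0")
      case True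
      \<comment> \<open>A list of defect zero is its own preimage, as \<open>switch 0 0\<close>
        changes nothing.\<close>
      then show thesis using that[of 0 0] large by (simp add: switch_def)
    next
      case False
      then obtain i j where "i < k" "j < k" "defect (switch i j ps) < defect ps"
        using switch_reduces_defect[of ps D] len d f large by auto
      then show thesis using that[of i j] ps by auto
    qed
    then have "switch i j ps \<in> ?S b" using ps switch_in_configs by auto
    moreover have "ps = switch i j (switch i j ps)" using ij len by (simp add: switch_switch)
    ultimately show "ps \<in> (\<lambda>((i, j), ps). switch i j ps) ` (({..<k} \<times> {..<k}) \<times> ?S b)"
      using ij by (intro image_eqI[where x = "((i, j), switch i j ps)"]) auto
  qed
  then have "card (?S (Suc b)) \<le> card ((\<lambda>((i, j), ps). switch i j ps) ` (({..<k} \<times> {..<k}) \<times> ?S b))"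
    using V by (intro card_mono) auto
  also have "\<dots> \<le> card (({..<k} \<times> {..<k}) \<times> ?S b)"
    using V by (intro card_image_le) auto
  finally show ?thesis by (simp add: card_cartesian_product power2_eq_square)
qed

lemma card_defect_le_simple:
  assumes V: "finite V" and f: "\<And>x. f x \<le> D" and large: "2 * (D * (D + 1)) + D < k"
  shows "card {ps \<in> configs (V \<times> V) f k. defect ps \<le> b} \<le> k ^ (2 * b) * card {ps \<in> configs (V \<times> V) f k. simple_config ps}"
proof (induction b)
  case 0
  show ?case using V by (auto intro!: card_mono simp: defect_zero_simple)
next
  case (Suc b)
  show ?case
    using order.trans[OF card_defect_Suc_le[OF assms, where b = b] mult_le_mono2[OF Suc.IH, of "k\<^sup>2"]]
    by (simp add: power_add power2_eq_square mult_ac)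
qed

section \<open>The number of simple configurations\<close>

abbreviation remove_nth :: "nat \<Rightarrow> 'a list \<Rightarrow> 'a list" where
  "remove_nth i ps \<equiv> take i ps @ drop (Suc i) ps"

lemma dec_le: "dec f x y \<le> f y"
  by (simp add: dec_def)

lemma deg_append: "deg (ps @ qs) x = deg ps x + deg qs x"
  by (induction ps) auto

lemma inj_on_remove_nth: "inj_on (remove_nth i) {ps. i < length ps \<and> ps ! i = p}"
proof (rule inj_on_inverseI)
  fix ps assume "ps \<in> {ps. i < length ps \<and> ps ! i = p}"
  then show "take i (remove_nth i ps) @ p # drop i (remove_nth i ps) = ps"
    using id_take_nth_drop[of i ps] by simp
qed

lemma remove_nth_configs:
  assumes "ps \<in> configs R f (Suc k)" "i < Suc k" "ps ! i = p"
  shows "remove_nth i ps \<in> configs R (dec (dec f (fst p)) (snd p)) k"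
    "0 < f (fst p)" "0 < dec f (fst p) (snd p)"
proof -
  have len: "length ps = Suc k" and set: "set ps \<subseteq> R" and deg: "deg ps = f"
    using assms by (auto simp: configs_def)
  have "ps = take i ps @ p # drop (Suc i) ps" using id_take_nth_drop[of i ps] assms len by simp
  then have f: "f x = deg (take i ps @ p # drop (Suc i) ps) x" for x using deg by simp
  have d: "dec (dec f (fst p)) (snd p) = deg (remove_nth i ps)"
    using f by (auto simp: dec_def fun_eq_iff deg_append)
  show "0 < f (fst p)" "0 < dec f (fst p) (snd p)"
    using f by (auto simp: dec_def deg_append)
  have "set (remove_nth i ps) \<subseteq> R"
    using set set_take_subset[of i ps] set_drop_subset[of "Suc i" ps] by auto
  then show "remove_nth i ps \<in> configs R (dec (dec f (fst p)) (snd p)) k"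
    using d len assms(2) by (auto simp: configs_def)
qed

text \<open>A quotient of two multinomial coefficients.\<close>

lemma card_configs_dec:
  assumes V: "finite V" and supp: "\<And>x. x \<notin> V \<Longrightarrow> f x = 0" and sum: "sum f V = 2 * Suc k"
    and p: "fst p \<in> V" "snd p \<in> V" "0 < f (fst p)" "0 < dec f (fst p) (snd p)"
  shows "card (configs (V \<times> V) (dec (dec f (fst p)) (snd p)) k) * ((2 * k + 2) * (2 * k + 1)) =
    card (configs (V \<times> V) f (Suc k)) * (f (fst p) * dec f (fst p) (snd p))"
proof -
  let ?g = "dec (dec f (fst p)) (snd p)"
  have s: "sum f V = Suc (Suc (sum ?g V))"
    using V p by (simp add: sum_dec[of V "fst p"] sum_dec[of V "snd p" "dec f (fst p)"])
  have F: "(\<Prod>v\<in>V. fact (f v)) = f (fst p) * (dec f (fst p) (snd p) * (\<Prod>v\<in>V. fact (?g v)))"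
    using V p prod_fact_dec[of V "fst p" f, where 'b = nat]
      prod_fact_dec[of V "snd p" "dec f (fst p)", where 'b = nat] by simp
  have 1: "card (configs (V \<times> V) f (Suc k)) * (\<Prod>v\<in>V. fact (f v)) = fact (2 * Suc k)"
    using V supp sum by (rule card_all_configs)
  have 2: "card (configs (V \<times> V) ?g k) * (\<Prod>v\<in>V. fact (?g v)) = fact (2 * k)"
    using s sum supp by (intro card_all_configs V) (auto simp: dec_def)
  have 3: "fact (2 * Suc k) = (2 * k + 2) * (2 * k + 1) * (fact (2 * k) :: nat)"
    by (simp add: algebra_simps)
  have nz: "(\<Prod>v\<in>V. fact (?g v)) \<noteq> (0::nat)" using V by simp
  have "card (configs (V \<times> V) ?g k) * ((2 * k + 2) * (2 * k + 1)) * (\<Prod>v\<in>V. fact (?g v)) =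
     ((2 * k + 2) * (2 * k + 1)) * (card (configs (V \<times> V) ?g k) * (\<Prod>v\<in>V. fact (?g v)))"
    by (simp only: mult_ac)
  also have "\<dots> = fact (2 * Suc k)" unfolding 2 3 ..
  also have "\<dots> = card (configs (V \<times> V) f (Suc k)) * (f (fst p) * dec f (fst p) (snd p)) * (\<Prod>v\<in>V. fact (?g v))"
    unfolding 1[symmetric] F by (simp only: mult_ac)
  finally show ?thesis using nz by (simp only: mult_cancel2) simp
qed

text \<open>Dividing by the number of all lists, a given pair occurs at a given position with
  probability at most \<open>(D / k)^2\<close>, where \<open>k\<close> is the length of the lists;
  the next two lemmas extract this for one and for two positions.\<close>

lemma card_configs_dec_le:
  assumes V: "finite V" and supp: "\<And>x. x \<notin> V \<Longrightarrow> f x = 0" and sum: "sum f V = 2 * Suc k"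
    and D: "\<And>x. f x \<le> D"
    and p: "fst p \<in> V" "snd p \<in> V" "0 < f (fst p)" "0 < dec f (fst p) (snd p)"
  shows "card (configs (V \<times> V) (dec (dec f (fst p)) (snd p)) k) * (Suc k)\<^sup>2 \<le> D\<^sup>2 * card (configs (V \<times> V) f (Suc k))"
proof -
  have "dec f (fst p) (snd p) \<le> D" using D[of "snd p"] dec_le[of f "fst p" "snd p"] by linarith
  have "card (configs (V \<times> V) (dec (dec f (fst p)) (snd p)) k) * (Suc k)\<^sup>2
    \<le> card (configs (V \<times> V) (dec (dec f (fst p)) (snd p)) k) * ((2 * k + 2) * (2 * k + 1))"
    unfolding power2_eq_square by (intro mult_le_mono2 mult_le_mono) auto
  also have "\<dots> = card (configs (V \<times> V) f (Suc k)) * (f (fst p) * dec f (fst p) (snd p))"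
    by (rule card_configs_dec[OF V supp sum p])
  also have "\<dots> \<le> card (configs (V \<times> V) f (Suc k)) * (D * D)"
    using D \<open>dec f (fst p) (snd p) \<le> D\<close> by (intro mult_le_mono2 mult_le_mono) auto
  finally show ?thesis by (simp add: power2_eq_square mult_ac)
qed

lemma card_configs_nth_le:
  assumes V: "finite V" and supp: "\<And>x. x \<notin> V \<Longrightarrow> f x = 0" and sum: "sum f V = 2 * Suc k"
    and D: "\<And>x. f x \<le> D" and i: "i < Suc k"
  shows "card {ps \<in> configs (V \<times> V) f (Suc k). ps ! i = p} * (Suc k)\<^sup>2 \<le> D\<^sup>2 * card (configs (V \<times> V) f (Suc k))"
proof (cases "{ps \<in> configs (V \<times> V) f (Suc k). ps ! i = p} = {}")
  case False
  let ?A = "{ps \<in> configs (V \<times> V) f (Suc k). ps ! i = p}"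
  let ?B = "configs (V \<times> V) (dec (dec f (fst p)) (snd p)) k"
  obtain ps where ps: "ps \<in> configs (V \<times> V) f (Suc k)" "ps ! i = p" using False by blast
  have "p \<in> V \<times> V" using ps i nth_mem[of i ps] by (auto simp: configs_def)
  then have p: "fst p \<in> V" "snd p \<in> V" by auto
  have sub: "?A \<subseteq> {ps. i < length ps \<and> ps ! i = p}" using i by (auto simp: configs_def)
  have "card ?A = card (remove_nth i ` ?A)"
    by (rule card_image[symmetric], rule inj_on_subset[OF inj_on_remove_nth sub])
  also have "\<dots> \<le> card ?B"
  proof (intro card_mono image_subsetI)
    fix qs assume "qs \<in> ?A"
    then show "remove_nth i qs \<in> ?B" using remove_nth_configs(1)[of qs "V \<times> V" f k i p] i by simp
  qed (simp add: V)
  finally have "card ?A * (Suc k)\<^sup>2 \<le> card ?B * (Suc k)\<^sup>2" by simp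
  also have "\<dots> \<le> D\<^sup>2 * card (configs (V \<times> V) f (Suc k))"
    by (rule card_configs_dec_le[OF V supp sum D p remove_nth_configs(2,3)[OF ps(1) i ps(2)]])
  finally show ?thesis .
next
  case True
  then show ?thesis by (simp only: card.empty)
qed

lemma card_configs_nth2_le:
  assumes V: "finite V" and supp: "\<And>x. x \<notin> V \<Longrightarrow> f x = 0" and sum: "sum f V = 2 * Suc (Suc k)"
    and D: "\<And>x. f x \<le> D" and ij: "i < j" "j < Suc (Suc k)"
  shows "card {ps \<in> configs (V \<times> V) f (Suc (Suc k)). ps ! i = p \<and> ps ! j = q} * ((Suc k)\<^sup>2 * (Suc (Suc k))\<^sup>2)
    \<le> D ^ 4 * card (configs (V \<times> V) f (Suc (Suc k)))"
proof (cases "{ps \<in> configs (V \<times> V) f (Suc (Suc k)). ps ! i = p \<and> ps ! j = q} = {}")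
  case False
  let ?A = "{ps \<in> configs (V \<times> V) f (Suc (Suc k)). ps ! i = p \<and> ps ! j = q}"
  let ?g = "dec (dec f (fst q)) (snd q)"
  let ?B = "configs (V \<times> V) ?g (Suc k)"
  obtain ps where ps: "ps \<in> configs (V \<times> V) f (Suc (Suc k))" "ps ! j = q" using False by blast
  have "q \<in> V \<times> V" using ps ij nth_mem[of j ps] by (auto simp: configs_def)
  then have q: "fst q \<in> V" "snd q \<in> V" by auto
  note q' = remove_nth_configs(2,3)[OF ps(1) ij(2) ps(2)]
  have sub: "?A \<subseteq> {ps. j < length ps \<and> ps ! j = q}" using ij by (auto simp: configs_def)
  have "card ?A = card (remove_nth j ` ?A)"
    by (rule card_image[symmetric], rule inj_on_subset[OF inj_on_remove_nth sub])
  \<comment> \<open>Since \<open>i < j\<close>, removing position \<open>j\<close> leaves position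
    \<open>i\<close> where it is.\<close>
  also have "\<dots> \<le> card {qs \<in> ?B. qs ! i = p}"
  proof (intro card_mono image_subsetI)
    fix qs assume qs: "qs \<in> ?A"
    then have "length qs = Suc (Suc k)" by (simp add: configs_def)
    then show "remove_nth j qs \<in> {qs \<in> ?B. qs ! i = p}"
      using remove_nth_configs(1)[of qs "V \<times> V" f "Suc k" j q] qs ij by (simp add: nth_append)
  qed (simp add: V)
  finally have "card ?A * (Suc k)\<^sup>2 \<le> card {qs \<in> ?B. qs ! i = p} * (Suc k)\<^sup>2" by simp
  also have "\<dots> \<le> D\<^sup>2 * card ?B"
  proof (rule card_configs_nth_le[OF V])
    have "sum f V = Suc (Suc (sum ?g V))"
      using V q q' by (simp add: sum_dec[of V "fst q"] sum_dec[of V "snd q" "dec f (fst q)"])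
    then show "sum ?g V = 2 * Suc k" using sum by simp
    show "?g x \<le> D" for x using D[of x] dec_le[of "dec f (fst q)" "snd q" x] dec_le[of f "fst q" x] by linarith
    show "?g x = 0" if "x \<notin> V" for x using supp[OF that] dec_le[of "dec f (fst q)" "snd q" x] dec_le[of f "fst q" x] by linarith
    show "i < Suc k" using ij by simp
  qed
  finally have "card ?A * (Suc k)\<^sup>2 * (Suc (Suc k))\<^sup>2 \<le> D\<^sup>2 * (card ?B * (Suc (Suc k))\<^sup>2)"
    by (simp only: mult.assoc[symmetric] mult_le_mono1)
  also have "\<dots> \<le> D\<^sup>2 * (D\<^sup>2 * card (configs (V \<times> V) f (Suc (Suc k))))"
    by (intro mult_le_mono2 card_configs_dec_le[OF V supp sum D q q'])
  finally show ?thesis by (simp only: mult.assoc power2_eq_square power4_eq_xxxx)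
next
  case True
  then show ?thesis by (simp only: card.empty)
qed

text \<open>Positions that hold no loop and do not repeat the edge of an earlier position carry
  distinct non-loop edges.\<close>

lemma defect_le:
  "defect ps \<le> card {i \<in> {..<length ps}. fst (ps ! i) = snd (ps ! i)} +
     card {(i, j) \<in> {..<length ps} \<times> {..<length ps}. i < j \<and> edge (ps ! i) = edge (ps ! j)}"
proof -
  let ?L = "{i \<in> {..<length ps}. fst (ps ! i) = snd (ps ! i)}"
  let ?P = "{(i, j) \<in> {..<length ps} \<times> {..<length ps}. i < j \<and> edge (ps ! i) = edge (ps ! j)}"
  let ?N = "{..<length ps} - ?L - snd ` ?P"
  have finP: "finite ?P" by (rule finite_subset[of _ "{..<length ps} \<times> {..<length ps}"]) auto
  have lt: False if ij: "i < j" "i \<in> ?N" "j \<in> ?N" "edge (ps ! i) = edge (ps ! j)" for i j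
  proof -
    have "(i, j) \<in> ?P" using ij(1,2,3) ij(4) by blast
    then have "j \<in> snd ` ?P" by (rule rev_image_eqI) simp
    with ij(3) show False by blast
  qed
  have "inj_on (\<lambda>i. edge (ps ! i)) ?N"
  proof (rule inj_onI)
    fix i j assume ij: "i \<in> ?N" "j \<in> ?N" "edge (ps ! i) = edge (ps ! j)"
    show "i = j"
      using lt[OF _ ij] lt[OF _ ij(2,1) ij(3)[symmetric]] by (meson linorder_neqE_nat)
  qed
  then have "card ?N = card ((\<lambda>i. edge (ps ! i)) ` ?N)" by (simp add: card_image)
  also have "\<dots> \<le> card (nonloop_edges ps)" by (intro card_mono) (auto simp: nonloop_edges_def)
  finally have N: "card ?N \<le> card (nonloop_edges ps)" .
  have "length ps = card {..<length ps}" by simp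
  also have "\<dots> \<le> card (?N \<union> (?L \<union> snd ` ?P))" using finP by (intro card_mono) auto
  also have "\<dots> \<le> card ?N + (card ?L + card (snd ` ?P))"
    by (rule order.trans[OF card_Un_le add_left_mono[OF card_Un_le]])
  also have "card (snd ` ?P) \<le> card ?P" using finP by (rule card_image_le)
  finally show ?thesis using N by (simp add: defect_def)
qed

text \<open>By Markov's inequality at least half of all lists have defect at most
  \<open>2 * B + 1\<close>, where \<open>B\<close> bounds the mean defect; each unit of defect costs
  a factor \<open>k^2\<close> by switching.\<close>

lemma card_simple_configs_ge:
  assumes V: "finite V" and supp: "\<And>x. x \<notin> V \<Longrightarrow> f x = 0" and sum: "sum f V = 2 * k"
    and D: "\<And>x. f x \<le> D" and cV: "card V \<le> 2 * k" and large: "2 * (D * (D + 1)) + D < k" and k2: "2 \<le> k"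
  shows "card (configs (V \<times> V) f k) \<le> 2 * k ^ (4 * (2 * D\<^sup>2 + 32 * D ^ 4) + 2) * card {ps \<in> configs (V \<times> V) f k. simple_config ps}"
proof -
  let ?C = "configs (V \<times> V) f k"
  define W where "W = real (card ?C)"
  define v where "v = real (card V)"
  \<comment> \<open>The first term comes from \<open>k\<close> positions that hold a loop with
    probability at most \<open>2 * D^2 / k\<close>, the second from at most \<open>k^2\<close> pairs
    of positions that agree with probability at most \<open>32 * D^4 / k^2\<close>.\<close>
  define B where "B = 2 * D\<^sup>2 + 32 * D ^ 4"
  have finC: "finite ?C" using V by simp
  have inV: "ps ! i \<in> V \<times> V" if "ps \<in> ?C" "i < k" for ps i
    using that nth_mem[of i ps] by (auto simp: configs_def)
  have kpos: "0 < real k" "0 < real k - 1" using k2 by auto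
  \<comment> \<open>The second bound, valid for \<open>k\<close> at least 2, is chosen to cancel the
    factor \<open>(k - 1)^2\<close> left by fixing two positions.\<close>
  have v4: "v \<le> 2 * real k" "v \<le> 4 * (real k - 1)" "0 \<le> v" using cV k2 by (auto simp: v_def)
  have loop: "real (card {ps \<in> ?C. fst (ps ! i) = snd (ps ! i)}) \<le> 2 * D\<^sup>2 * W / k" if "i < k" for i
  proof -
    have one: "real (card {ps \<in> ?C. ps ! i = p}) \<le> D\<^sup>2 * W / (real k)\<^sup>2" for p
    proof -
      have e: "Suc (k - 1) = k" using k2 by simp
      have "card {ps \<in> ?C. ps ! i = p} * k\<^sup>2 \<le> D\<^sup>2 * card ?C"
        using card_configs_nth_le[where f = f and k = "k - 1", unfolded e, OF V supp sum D that] .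
      then have "real (card {ps \<in> ?C. ps ! i = p} * k\<^sup>2) \<le> real (D\<^sup>2 * card ?C)" by (rule of_nat_mono)
      then show ?thesis using kpos by (simp add: W_def field_simps)
    qed
    have "{ps \<in> ?C. fst (ps ! i) = snd (ps ! i)} \<subseteq> (\<Union>u\<in>V. {ps \<in> ?C. ps ! i = (u, u)})"
      using inV[OF _ that] by (auto simp: prod_eq_iff mem_Times_iff)
    then have "card {ps \<in> ?C. fst (ps ! i) = snd (ps ! i)} \<le> card (\<Union>u\<in>V. {ps \<in> ?C. ps ! i = (u, u)})"
      using V finC by (intro card_mono) auto
    also have "\<dots> \<le> (\<Sum>u\<in>V. card {ps \<in> ?C. ps ! i = (u, u)})" using V by (rule card_UN_le)
    finally have "real (card {ps \<in> ?C. fst (ps ! i) = snd (ps ! i)}) \<le> (\<Sum>u\<in>V. real (card {ps \<in> ?C. ps ! i = (u, u)}))"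
      using of_nat_mono by fastforce
    also have "\<dots> \<le> (\<Sum>u\<in>V. D\<^sup>2 * W / (real k)\<^sup>2)" by (intro sum_mono one)
    also have "\<dots> = v * (D\<^sup>2 * W / (real k)\<^sup>2)" by (simp add: v_def)
    also have "\<dots> \<le> 2 * k * (D\<^sup>2 * W / (real k)\<^sup>2)" using v4 by (intro mult_right_mono) (auto simp: W_def)
    also have "\<dots> = 2 * D\<^sup>2 * W / k" using kpos by (simp add: field_simps power2_eq_square)
    finally show ?thesis .
  qed
  have pair: "real (card {ps \<in> ?C. i < j \<and> edge (ps ! i) = edge (ps ! j)}) \<le> 32 * D ^ 4 * W / (real k)\<^sup>2"
    if "i < k" "j < k" for i j
  proof (cases "i < j")
    case True
    have one: "real (card {ps \<in> ?C. ps ! i = p \<and> ps ! j = q}) \<le> D ^ 4 * W / ((real k - 1)\<^sup>2 * (real k)\<^sup>2)" for p q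
    proof -
      obtain m where m: "k = Suc (Suc m)" using k2 by (metis add_2_eq_Suc le_Suc_ex)
      then have m1: "Suc m = k - 1" by simp
      have "card {ps \<in> ?C. ps ! i = p \<and> ps ! j = q} * ((k - 1)\<^sup>2 * k\<^sup>2) \<le> D ^ 4 * card ?C"
        using card_configs_nth2_le[where f = f, OF V supp sum[unfolded m] D True that(2)[unfolded m], folded m] m1
        by (simp only: not_False_eq_True)
      then have "real (card {ps \<in> ?C. ps ! i = p \<and> ps ! j = q} * ((k - 1)\<^sup>2 * k\<^sup>2)) \<le> real (D ^ 4 * card ?C)"
        by (rule of_nat_mono)
      moreover have "real (k - 1) = real k - 1" using k2 by simp
      ultimately have "real (card {ps \<in> ?C. ps ! i = p \<and> ps ! j = q}) * ((real k - 1)\<^sup>2 * (real k)\<^sup>2) \<le> D ^ 4 * W"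
        by (simp add: W_def)
      then show ?thesis using kpos by (subst pos_le_divide_eq) auto
    qed
    let ?S = "\<lambda>p q. {ps \<in> ?C. ps ! i = p \<and> ps ! j = q}"
    \<comment> \<open>Two pairs have the same edge if they are equal or reversed.\<close>
    have "{ps \<in> ?C. i < j \<and> edge (ps ! i) = edge (ps ! j)} \<subseteq> (\<Union>p\<in>V \<times> V. ?S p p \<union> ?S p (prod.swap p))"
    proof
      fix ps assume ps: "ps \<in> {ps \<in> ?C. i < j \<and> edge (ps ! i) = edge (ps ! j)}"
      then have "ps ! j = ps ! i \<or> ps ! j = prod.swap (ps ! i)"
        by (auto simp: doubleton_eq_iff prod_eq_iff)
      then show "ps \<in> (\<Union>p\<in>V \<times> V. ?S p p \<union> ?S p (prod.swap p))"
        using ps inV[OF _ that(1)] by (intro UN_I[of "ps ! i"]) auto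
    qed
    then have "card {ps \<in> ?C. i < j \<and> edge (ps ! i) = edge (ps ! j)} \<le> card (\<Union>p\<in>V \<times> V. ?S p p \<union> ?S p (prod.swap p))"
      using V finC by (intro card_mono) auto
    also have "\<dots> \<le> (\<Sum>p\<in>V \<times> V. card (?S p p \<union> ?S p (prod.swap p)))" using V by (intro card_UN_le) auto
    also have "\<dots> \<le> (\<Sum>p\<in>V \<times> V. card (?S p p) + card (?S p (prod.swap p)))" by (intro sum_mono card_Un_le)
    finally have "real (card {ps \<in> ?C. i < j \<and> edge (ps ! i) = edge (ps ! j)})
        \<le> (\<Sum>p\<in>V \<times> V. real (card (?S p p)) + real (card (?S p (prod.swap p))))"
      using of_nat_mono by fastforce
    also have "\<dots> \<le> (\<Sum>p\<in>V \<times> V. D ^ 4 * W / ((real k - 1)\<^sup>2 * (real k)\<^sup>2) + D ^ 4 * W / ((real k - 1)\<^sup>2 * (real k)\<^sup>2))"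
      by (intro sum_mono add_mono one)
    also have "\<dots> = v\<^sup>2 * (2 * (D ^ 4 * W / ((real k - 1)\<^sup>2 * (real k)\<^sup>2)))"
      by (simp add: v_def card_cartesian_product power2_eq_square mult_ac)
    also have "\<dots> \<le> (4 * (real k - 1))\<^sup>2 * (2 * (D ^ 4 * W / ((real k - 1)\<^sup>2 * (real k)\<^sup>2)))"
      using v4 by (intro mult_right_mono power_mono) (auto simp: W_def)
    also have "\<dots> = 32 * D ^ 4 * W / (real k)\<^sup>2"
    proof -
      have "(4 * z)\<^sup>2 * (2 * (A * W / (z\<^sup>2 * y))) = 32 * A * W / y" if "z > 0" for z y A :: real
        using that by (simp add: power_mult_distrib)
      from this[OF kpos(2)] show ?thesis by simp
    qed
    finally show ?thesis .
  qed (auto simp: W_def)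
  have "(\<Sum>ps\<in>?C. real (defect ps)) \<le>
    (\<Sum>ps\<in>?C. (\<Sum>i<k. of_bool (fst (ps ! i) = snd (ps ! i))) +
       (\<Sum>ij\<in>{..<k}\<times>{..<k}. of_bool (fst ij < snd ij \<and> edge (ps ! fst ij) = edge (ps ! snd ij))))"
  proof (intro sum_mono)
    fix ps assume "ps \<in> ?C"
    then have len: "length ps = k" by (simp add: configs_def)
    have 1: "(\<Sum>i<k. of_bool (fst (ps ! i) = snd (ps ! i)) :: real) = card {i \<in> {..<k}. fst (ps ! i) = snd (ps ! i)}"
      by (simp add: Int_def)
    have 2: "(\<Sum>ij\<in>{..<k}\<times>{..<k}. of_bool (fst ij < snd ij \<and> edge (ps ! fst ij) = edge (ps ! snd ij)) :: real)
      = card {(i, j) \<in> {..<k} \<times> {..<k}. i < j \<and> edge (ps ! i) = edge (ps ! j)}"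
      by (simp add: Int_def) (rule arg_cong[where f = card], auto)
    show "real (defect ps) \<le> (\<Sum>i<k. of_bool (fst (ps ! i) = snd (ps ! i))) +
       (\<Sum>ij\<in>{..<k}\<times>{..<k}. of_bool (fst ij < snd ij \<and> edge (ps ! fst ij) = edge (ps ! snd ij)))"
      unfolding 1 2 using of_nat_mono[OF defect_le[of ps], where 'a = real] unfolding len by simp
  qed
  also have "\<dots> = (\<Sum>i<k. \<Sum>ps\<in>?C. of_bool (fst (ps ! i) = snd (ps ! i))) +
       (\<Sum>ij\<in>{..<k}\<times>{..<k}. \<Sum>ps\<in>?C. of_bool (fst ij < snd ij \<and> edge (ps ! fst ij) = edge (ps ! snd ij)))"
    unfolding sum.distrib by (intro arg_cong2[where f = "(+)"] sum.swap)
  also have "\<dots> = (\<Sum>i<k. real (card {ps \<in> ?C. fst (ps ! i) = snd (ps ! i)})) +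
       (\<Sum>ij\<in>{..<k}\<times>{..<k}. real (card {ps \<in> ?C. fst ij < snd ij \<and> edge (ps ! fst ij) = edge (ps ! snd ij)}))"
    using finC by (simp add: Int_def)
  also have "\<dots> \<le> (\<Sum>i<k. 2 * D\<^sup>2 * W / k) + (\<Sum>ij\<in>{..<k}\<times>{..<k}. 32 * D ^ 4 * W / (real k)\<^sup>2)"
    by (intro add_mono sum_mono loop pair) auto
  also have "\<dots> = B * W"
    using kpos by (simp add: card_cartesian_product B_def power2_eq_square algebra_simps)
  finally have mean: "(\<Sum>ps\<in>?C. real (defect ps)) \<le> B * W" .
  \<comment> \<open>The threshold exceeds \<open>2 * B\<close> by one so that it is positive and can
    be cancelled.\<close>
  let ?G = "{ps \<in> ?C. defect ps \<le> 2 * B + 1}" and ?H = "{ps \<in> ?C. \<not> defect ps \<le> 2 * B + 1}"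
  have "real (card ?H) * (2 * real B + 1) = (\<Sum>ps\<in>?H. 2 * real B + 1)" by simp
  also have "\<dots> \<le> (\<Sum>ps\<in>?H. real (defect ps))" by (intro sum_mono) auto
  also have "\<dots> \<le> (\<Sum>ps\<in>?C. real (defect ps))" using finC by (intro sum_mono2) auto
  also note mean
  also have "real B * W \<le> (W / 2) * (2 * real B + 1)" by (simp add: W_def algebra_simps)
  finally have H: "real (card ?H) \<le> W / 2" by (subst (asm) mult_le_cancel_right) auto
  have "?C = ?G \<union> ?H" by auto
  then have "card ?C = card ?G + card ?H" using finC by (metis (no_types, lifting) card_Un_disjoint finite_Un disjoint_iff mem_Collect_eq)
  with H have "card ?C \<le> 2 * card ?G" by (simp add: W_def)
  also have "card ?G \<le> k ^ (2 * (2 * B + 1)) * card {ps \<in> ?C. simple_config ps}"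
    by (rule card_defect_le_simple[OF V D large])
  finally show ?thesis by (simp add: B_def algebra_simps)
qed

section \<open>The exponential rate\<close>

text \<open>Here \<open>\<kappa>\<close> is the ratio of the generating function variables to the class sizes on the holes, scaled so that it is 1 on the rest.\<close>

definition rate :: "real \<Rightarrow> nat \<Rightarrow> real \<Rightarrow> real" where
  "rate \<kappa> d l = - (2 * l * ln (l / 2)) - (1 - 2 * l) * ln (1 - 2 * l) - 2 * d * l * ln \<kappa>
     + d / 2 * ln ((2 * \<kappa> * l + (1 - 2 * l))\<^sup>2 - \<kappa>\<^sup>2 * l\<^sup>2)"

section \<open>Numerical bounds for logarithms and the sign of the rate\<close>

lemma ln_series_bounds:
  fixes y :: real
  assumes "0 < y" "y < 1"
  shows "2 * (y + y ^ 3 / 3 + y ^ 5 / 5 + y ^ 7 / 7 + y ^ 9 / 9 + y ^ 11 / 11) \<le> ln ((1 + y) / (1 - y))"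
    "ln ((1 + y) / (1 - y)) \<le> 2 * (y + y ^ 3 / 3 + y ^ 5 / 5 + y ^ 7 / 7 + y ^ 9 / 9 + y ^ 11 / 11) + 2 * (y ^ 13 / (1 - y\<^sup>2) / 13)"
proof -
  have x: "1 < (1 + y) / (1 - y)" using assms by (simp add: field_simps)
  have y: "((1 + y) / (1 - y) - 1) / ((1 + y) / (1 - y) + 1) = y" using assms by (simp add: field_simps)
  have s: "(\<Sum>k<6. 2 * y ^ (2 * k + 1) / real (2 * k + 1)) =
    2 * (y + y ^ 3 / 3 + y ^ 5 / 5 + y ^ 7 / 7 + y ^ 9 / 9 + y ^ 11 / 11)"
    by (simp add: eval_nat_numeral)
  show "2 * (y + y ^ 3 / 3 + y ^ 5 / 5 + y ^ 7 / 7 + y ^ 9 / 9 + y ^ 11 / 11) \<le> ln ((1 + y) / (1 - y))"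
    "ln ((1 + y) / (1 - y)) \<le> 2 * (y + y ^ 3 / 3 + y ^ 5 / 5 + y ^ 7 / 7 + y ^ 9 / 9 + y ^ 11 / 11) + 2 * (y ^ 13 / (1 - y\<^sup>2) / 13)"
    using ln_approx_bounds[OF x, of 6] unfolding y s by simp_all
qed

text \<open>The bounds for \<open>ln ((1 + y) / (1 - y)) = 2 * artanh y\<close> are used with
  \<open>y\<close> rounded to a short decimal in the safe direction, which keeps the rational
  arithmetic small.\<close>

lemma ln_le_series:
  fixes x y :: real
  assumes "0 < y" "y < 1" "0 < x" "x \<le> (1 + y) / (1 - y)"
  shows "ln x \<le> 2 * (y + y ^ 3 / 3 + y ^ 5 / 5 + y ^ 7 / 7 + y ^ 9 / 9 + y ^ 11 / 11) + 2 * (y ^ 13 / (1 - y\<^sup>2) / 13)"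
  using ln_mono[OF assms(4,3)] ln_series_bounds(2)[OF assms(1,2)] by linarith

lemma series_le_ln:
  fixes x y :: real
  assumes "0 < y" "y < 1" "(1 + y) / (1 - y) \<le> x"
  shows "2 * (y + y ^ 3 / 3 + y ^ 5 / 5 + y ^ 7 / 7 + y ^ 9 / 9 + y ^ 11 / 11) \<le> ln x"
proof -
  have "0 < (1 + y) / (1 - y)" using assms by simp
  from ln_mono[OF assms(3) this] ln_series_bounds(1)[OF assms(1,2)] show ?thesis by linarith
qed

text \<open>The minimum over \<open>\<kappa>\<close> is attained close to \<open>65 / 54\<close>; \<open>158769 / 500000\<close> approximates \<open>(c - 2) / (2 * c) = 0.3175382...\<close> from below.\<close>

lemma rate_negative: "rate (65 / 54) 27 (158769 / 500000) < - 1 / 100000"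
proof -
  \<comment> \<open>Powers of 2 are split off so that the arguments lie near 1, where six terms of
    the series are accurate enough. Each \<open>y\<close> is \<open>(x - 1) / (x + 1)\<close>, exact
    or rounded up.\<close>
  have a: "ln 2 \<le> (0.69314720 :: real)"
    using ln_le_series[of "1 / 3" 2] by (simp add: power_divide)
  have b: "ln (250000 / 158769) \<le> (0.45401065 :: real)"
    using ln_le_series[of "0.22318474" "250000 / 158769"] by (simp add: power_divide)
  have c: "ln (125000 / 91231) \<le> (0.31491902 :: real)"
    using ln_le_series[of "0.15617095" "125000 / 91231"] by (simp add: power_divide)
  \<comment> \<open>The logarithm of \<open>\<kappa>\<close> enters the rate with negative sign,
    hence a lower bound.\<close>
  have d: "(0.18540320 :: real) \<le> ln (65 / 54)"
    using series_le_ln[of "11 / 119" "65 / 54"] by (simp add: power_divide)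
  \<comment> \<open>The argument is the exact value of the base
    \<open>(2 * \<kappa> * l + (1 - 2 * l))^2 - \<kappa>^2 * l^2\<close>.\<close>
  have e: "ln (1129377171131 / 1000000000000) \<le> (0.12166633 :: real)"
    using ln_le_series[of "0.06075823" "1129377171131 / 1000000000000"] by (simp add: power_divide)
  have inv1: "ln (inverse (2 * (2 * x))) = - (2 * ln 2) - ln x" if "0 < x" for x :: real
    using ln_inverse[of "2 * (2 * x)"] ln_mult_pos[of 2 "2 * x"] ln_mult_pos[of 2 x] that by (simp del: inverse_mult_distrib)
  have inv2: "ln (inverse (2 * x)) = - ln 2 - ln x" if "0 < x" for x :: real
    using ln_inverse[of "2 * x"] ln_mult_pos[of 2 x] that by (simp del: inverse_mult_distrib)
  have l1: "ln (158769 / 1000000 :: real) = - (2 * ln 2) - ln (250000 / 158769)"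
    using inv1[of "250000 / 158769"] by simp
  have l2: "ln (91231 / 250000 :: real) = - ln 2 - ln (125000 / 91231)"
    using inv2[of "125000 / 91231"] by simp
  have "rate (65 / 54) 27 (158769 / 500000) =
    158769 / 250000 * (2 * ln 2 + ln (250000 / 158769)) + 91231 / 250000 * (ln 2 + ln (125000 / 91231))
      - 54 * (158769 / 500000) * ln (65 / 54) + 27 / 2 * ln (1129377171131 / 1000000000000)"
    using l1 l2 by (simp add: rate_def power2_eq_square) (simp add: field_simps)
  also have "\<dots> \<le> 158769 / 250000 * (2 * 0.69314720 + 0.45401065) + 91231 / 250000 * (0.69314720 + 0.31491902)
      - 54 * (158769 / 500000) * 0.18540320 + 27 / 2 * 0.12166633"
    by (intro add_mono diff_mono mult_left_mono a b c d e) simp_all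
  also have "\<dots> < - 1 / 100000" by simp
  finally show ?thesis .
qed

section \<open>Continuity of the rate, and factorials up to a linear factor\<close>

lemma rate_base_pos:
  fixes \<kappa> l :: real
  assumes "0 < \<kappa>" "0 < l" "2 * l < 1"
  shows "0 < (2 * \<kappa> * l + (1 - 2 * l))\<^sup>2 - \<kappa>\<^sup>2 * l\<^sup>2"
proof -
  have "\<kappa> * l < 2 * \<kappa> * l + (1 - 2 * l)" using assms by (simp add: add_pos_pos)
  then have "(\<kappa> * l)\<^sup>2 < (2 * \<kappa> * l + (1 - 2 * l))\<^sup>2"
    using assms by (intro power_strict_mono) auto
  then show ?thesis by (simp add: power_mult_distrib)
qed

lemma continuous_rate:
  assumes "0 < \<kappa>" "0 < l" "2 * l < 1"
  shows "isCont (rate \<kappa> d) l"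
proof -
  have "0 < (2 * \<kappa> * l + (1 - 2 * l))\<^sup>2 - \<kappa>\<^sup>2 * l\<^sup>2" using assms by (rule rate_base_pos)
  then show ?thesis
    unfolding rate_def using assms by (intro continuous_intros) auto
qed

text \<open>In logarithmic form, the convex function \<open>a * ln a\<close> lies above its tangent
  at \<open>x\<close>.\<close>

lemma power_self_ge:
  assumes "0 < x"
  shows "x ^ a * exp (real a - x) \<le> real a ^ a"
proof (cases "a = 0")
  case False
  have "x / a \<le> exp (x / a - 1)" using exp_ge_add_one_self[of "x / a - 1"] by simp
  then have "(x / a) ^ a \<le> exp (x / a - 1) ^ a" using assms by (intro power_mono) auto
  also have "\<dots> = exp (x - a)" using False by (simp flip: exp_of_nat_mult add: algebra_simps)
  finally have "x ^ a \<le> exp (x - a) * real a ^ a" using False by (simp add: power_divide field_simps)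
  then have "x ^ a * exp (real a - x) \<le> exp (x - a) * real a ^ a * exp (real a - x)"
    by (intro mult_right_mono) auto
  also have "\<dots> = real a ^ a * (exp (x - a) * exp (real a - x))" by (simp add: mult_ac)
  also have "\<dots> = real a ^ a" by (simp flip: exp_add)
  finally show ?thesis .
qed (use assms in simp)

lemma power_self_le_fact: "real n ^ n * exp (- real n) \<le> fact n"
proof (induction n)
  case (Suc n)
  have "real (Suc n) ^ n \<le> exp 1 * real n ^ n"
  proof (cases "n = 0")
    case False
    have "(1 + 1 / n) ^ n \<le> exp (1 / n) ^ n" by (intro power_mono) auto
    also have "\<dots> = exp 1" using False by (simp flip: exp_of_nat_mult)
    finally have "(1 + 1 / n) ^ n * real n ^ n \<le> exp 1 * real n ^ n" by (intro mult_right_mono) auto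
    moreover have "(1 + 1 / real n) * real n = real (Suc n)" using False by (simp add: field_simps)
    ultimately show ?thesis by (simp only: power_mult_distrib[symmetric])
  qed simp
  then have "real (Suc n) ^ Suc n * exp (- real (Suc n)) \<le> real (Suc n) * (exp 1 * real n ^ n) * exp (- real (Suc n))"
    unfolding power_Suc by (intro mult_right_mono mult_left_mono) auto
  also have "\<dots> = real (Suc n) * (real n ^ n * (exp 1 * exp (- real (Suc n))))"
    by (simp only: mult_ac)
  also have "exp 1 * exp (- real (Suc n)) = exp (- real n)" by (simp flip: exp_add)
  also have "real (Suc n) * (real n ^ n * exp (- real n)) \<le> real (Suc n) * fact n" by (intro mult_left_mono Suc.IH) auto
  finally show ?case by simp
qed simp

text \<open>The quotient of \<open>fact n\<close> by \<open>n * (n ^ n * exp (- n))\<close> does not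
  increase and equals \<open>exp 1\<close> at \<open>n = 1\<close>. The factor \<open>n + 1\<close>
  in place of \<open>n\<close> includes the case \<open>n = 0\<close>.\<close>

lemma fact_le_power_self: "fact n \<le> exp 1 * (real n + 1) * (real n ^ n * exp (- real n))"
proof (cases "n = 0")
  case False
  have "fact (Suc m) \<le> exp 1 * real (Suc m) * (real (Suc m) ^ Suc m * exp (- real (Suc m)))" for m
  proof (induction m)
    case (Suc m)
    let ?a = "real (Suc m)"
    have "(1 - 1 / (?a + 1)) ^ (Suc (Suc m)) \<le> exp (- (1 / (?a + 1))) ^ (Suc (Suc m))"
      using exp_ge_add_one_self[of "- (1 / (?a + 1))"] by (intro power_mono) auto
    also have "\<dots> = exp (real (Suc (Suc m)) * (- (1 / (?a + 1))))" by (rule exp_of_nat_mult[symmetric])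
    also have "real (Suc (Suc m)) * (- (1 / (?a + 1))) = - 1" by (simp add: field_simps)
    also have "1 - 1 / (?a + 1) = ?a / (?a + 1)" by (simp add: field_simps)
    finally have "?a ^ Suc (Suc m) \<le> exp (- 1) * (?a + 1) ^ Suc (Suc m)"
      by (simp only: power_divide) (simp add: field_simps del: power_Suc)
    then have "?a ^ Suc (Suc m) * exp (- ?a) \<le> exp (- 1) * (?a + 1) ^ Suc (Suc m) * exp (- ?a)"
      by (intro mult_right_mono) auto
    also have "\<dots> = (?a + 1) ^ Suc (Suc m) * (exp (- 1) * exp (- ?a))" by (simp only: mult_ac)
    also have "exp (- 1) * exp (- ?a) = exp (- (?a + 1))" by (simp flip: exp_add)
    finally have *: "?a ^ Suc (Suc m) * exp (- ?a) \<le> (?a + 1) ^ Suc (Suc m) * exp (- (?a + 1))" .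
    have "(fact (Suc (Suc m)) :: real) = (?a + 1) * fact (Suc m)" by (simp add: algebra_simps)
    also have "\<dots> \<le> (?a + 1) * (exp 1 * ?a * (?a ^ Suc m * exp (- ?a)))"
      using Suc.IH by (intro mult_left_mono) auto
    also have "\<dots> = exp 1 * (?a + 1) * (?a ^ Suc (Suc m) * exp (- ?a))" by (simp only: power_Suc mult_ac)
    also have "\<dots> \<le> exp 1 * (?a + 1) * ((?a + 1) ^ Suc (Suc m) * exp (- (?a + 1)))"
      by (intro mult_left_mono *) auto
    also have "?a + 1 = real (Suc (Suc m))" by simp
    finally show ?case .
  qed (simp flip: exp_add)
  from this[of "n - 1"] False
  have "fact n \<le> exp 1 * real n * (real n ^ n * exp (- real n))" by simp
  also have "\<dots> \<le> exp 1 * (real n + 1) * (real n ^ n * exp (- real n))"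
    by (intro mult_right_mono mult_left_mono) auto
  finally show ?thesis .
qed simp

section \<open>First moment bound\<close>

definition typings :: "nat \<Rightarrow> nat set \<Rightarrow> (nat \<Rightarrow> nat) \<Rightarrow> (nat \<Rightarrow> nat) set" where
  "typings N T s = {\<tau> \<in> {..<N} \<rightarrow>\<^sub>E T. \<forall>t\<in>T. card {v \<in> {..<N}. \<tau> v = t} = s t}"

lemma finite_typings: "finite T \<Longrightarrow> finite (typings N T s)"
  by (rule finite_subset[of _ "{..<N} \<rightarrow>\<^sub>E T"]) (auto simp: typings_def intro: finite_PiE)

text \<open>Give each vertex the weight \<open>s t\<close> of its class \<open>t\<close>. Every
  typing then has product weight \<open>\<Prod>t\<in>T. s t ^ s t\<close>, while all maps together
  weigh \<open>(\<Sum>t\<in>T. s t) ^ N\<close>.\<close>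

lemma card_typings_le:
  assumes "finite T"
  shows "card (typings N T s) * (\<Prod>t\<in>T. s t ^ s t) \<le> (\<Sum>t\<in>T. s t) ^ N"
proof -
  have "card (typings N T s) * (\<Prod>t\<in>T. s t ^ s t) = (\<Sum>\<tau>\<in>typings N T s. \<Prod>t\<in>T. s t ^ s t)"
    by simp
  also have "\<dots> = (\<Sum>\<tau>\<in>typings N T s. \<Prod>v<N. s (\<tau> v))"
  proof (intro sum.cong refl)
    fix \<tau> assume \<tau>: "\<tau> \<in> typings N T s"
    have "(\<Prod>v<N. s (\<tau> v)) = (\<Prod>t\<in>T. \<Prod>v | v \<in> {..<N} \<and> \<tau> v = t. s (\<tau> v))"
      using \<tau> assms by (intro prod.group[symmetric]) (auto simp: typings_def)
    also have "\<dots> = (\<Prod>t\<in>T. s t ^ s t)"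
      using \<tau> by (intro prod.cong) (auto simp: typings_def)
    finally show "(\<Prod>t\<in>T. s t ^ s t) = (\<Prod>v<N. s (\<tau> v))" ..
  qed
  also have "\<dots> \<le> (\<Sum>\<tau>\<in>{..<N} \<rightarrow>\<^sub>E T. \<Prod>v<N. s (\<tau> v))"
    using assms by (intro sum_mono2) (auto simp: typings_def intro: finite_PiE)
  also have "\<dots> = (\<Prod>v<N. \<Sum>t\<in>T. s t)"
    using assms by (intro prod_sum_PiE[symmetric]) auto
  finally show ?thesis by simp
qed

text \<open>Classes 0, 1 and 2, 3 are the sides of the two holes, class 4 contains the remaining vertices.\<close>

definition part_size :: "nat \<Rightarrow> nat \<Rightarrow> nat \<Rightarrow> nat \<Rightarrow> nat" where
  "part_size A B C t = (if t < 2 then A else if t < 4 then B else C)"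

definition allowed :: "(nat \<times> nat) set" where
  "allowed = {..<5} \<times> {..<5} - {(0, 1), (1, 0), (2, 3), (3, 2)}"

definition hole_pairs :: "nat \<Rightarrow> (nat \<Rightarrow> nat) \<Rightarrow> (nat \<times> nat) set" where
  "hole_pairs N \<tau> = {(u, v) \<in> {..<N} \<times> {..<N}. (\<tau> u, \<tau> v) \<in> allowed}"

lemma lessThan_5: "{..<5} = {0, 1, 2, 3, 4 :: nat}"
  by auto

lemma sum_allowed:
  fixes y :: "nat \<Rightarrow> real"
  shows "(\<Sum>p\<in>allowed. y (fst p) * y (snd p)) =
    (y 0 + y 1 + y 2 + y 3 + y 4)\<^sup>2 - 2 * y 0 * y 1 - 2 * y 2 * y 3"
proof -
  have "(\<Sum>p\<in>allowed. y (fst p) * y (snd p)) = (\<Sum>p\<in>{..<5}\<times>{..<5}. y (fst p) * y (snd p))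
     - (\<Sum>p\<in>{(0, 1), (1, 0), (2, 3), (3, 2)}. y (fst p) * y (snd p))"
    unfolding allowed_def by (intro sum_diff) auto
  also have "(\<Sum>p\<in>{..<5}\<times>{..<5}. y (fst p) * y (snd p)) = (\<Sum>s\<in>{..<5}. y s)\<^sup>2"
    by (simp add: power2_eq_square sum_product sum.cartesian_product' )
  finally show ?thesis by (simp add: lessThan_5 add.assoc)
qed

lemma hole_configs_le:
  assumes \<tau>: "\<tau> \<in> typings N {..<5} (part_size A B C)"
    and \<kappa>: "0 < \<kappa>" and k: "k = d * N div 2"
  shows "real (card (configs (hole_pairs N \<tau>) (\<lambda>v. if v < N then d else 0) k)) * fact d ^ N *
      (\<kappa> ^ (2 * d * (A + B)) * (\<Prod>t<5. real (part_size A B C t) ^ part_size A B C t) ^ d)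
    \<le> (\<Prod>t<5. fact (d * part_size A B C t)) *
       ((2 * \<kappa> * (A + B) + C)\<^sup>2 - \<kappa>\<^sup>2 * (A + B)\<^sup>2) ^ k"
proof -
  let ?s = "part_size A B C" and ?f = "\<lambda>v. if v < N then d else 0"
  \<comment> \<open>Proportional to the class sizes; \<open>\<kappa>\<close> lowers or raises the
    hole classes relative to the rest.\<close>
  define y where "y t = (if t < 4 then \<kappa> * ?s t else real C)" for t :: nat
  have n: "(\<Sum>v | v \<in> {..<N} \<and> \<tau> v = t. ?f v) = d * ?s t" if "t \<in> {..<5}" for t
  proof -
    have "(\<Sum>v | v \<in> {..<N} \<and> \<tau> v = t. ?f v) = (\<Sum>v | v \<in> {..<N} \<and> \<tau> v = t. d)"
      by (intro sum.cong) auto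
    then show ?thesis using \<tau> that by (simp add: typings_def)
  qed
  have F: "(\<Prod>v<N. fact (?f v)) = (fact d ^ N :: real)" by simp
  have Y: "(\<Prod>t<5. y t ^ (\<Sum>v | v \<in> {..<N} \<and> \<tau> v = t. ?f v)) = \<kappa> ^ (2 * d * (A + B)) * (\<Prod>t<5. real (?s t) ^ ?s t) ^ d"
  proof -
    have "(\<Prod>t<5. y t ^ (\<Sum>v | v \<in> {..<N} \<and> \<tau> v = t. ?f v)) = (\<Prod>t<5. y t ^ (d * ?s t))"
      by (intro prod.cong refl) (simp only: n)
    also have "\<dots> = (\<kappa> ^ (d * A) * \<kappa> ^ (d * A) * \<kappa> ^ (d * B) * \<kappa> ^ (d * B)) * (\<Prod>t<5. real (?s t) ^ (d * ?s t))"
      by (simp add: lessThan_5 y_def part_size_def power_mult_distrib mult_ac)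
    also have "\<kappa> ^ (d * A) * \<kappa> ^ (d * A) * \<kappa> ^ (d * B) * \<kappa> ^ (d * B) = \<kappa> ^ (2 * d * (A + B))"
    proof -
      have "d * A + d * A + d * B + d * B = 2 * d * (A + B)" by (simp add: algebra_simps)
      then show ?thesis by (simp only: power_add[symmetric])
    qed
    also have "(\<Prod>t<5. real (?s t) ^ (d * ?s t)) = (\<Prod>t<5. real (?s t) ^ ?s t) ^ d"
      unfolding prod_power_distrib by (intro prod.cong refl) (simp add: power_mult[symmetric] mult.commute)
    finally show ?thesis .
  qed
  have fact: "(\<Prod>t<5. fact (\<Sum>v | v \<in> {..<N} \<and> \<tau> v = t. ?f v) :: real) = (\<Prod>t<5. fact (d * ?s t))"
    by (intro prod.cong refl) (simp only: n)
  have y0: "0 \<le> y t" for t using \<kappa> by (simp add: y_def)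
  have "real (card (configs (hole_pairs N \<tau>) ?f k)) * (\<Prod>v<N. fact (?f v)) * (\<Prod>t<5. y t ^ (\<Sum>v | v \<in> {..<N} \<and> \<tau> v = t. ?f v))
    \<le> (\<Prod>t<5. fact (\<Sum>v | v \<in> {..<N} \<and> \<tau> v = t. ?f v)) * (\<Sum>p\<in>allowed. y (fst p) * y (snd p)) ^ k"
    using \<tau> y0 by (intro card_configs_types_le) (auto simp: hole_pairs_def allowed_def typings_def)
  also have "\<dots> \<le> (\<Prod>t<5. fact (\<Sum>v | v \<in> {..<N} \<and> \<tau> v = t. ?f v)) *
      ((2 * \<kappa> * (A + B) + C)\<^sup>2 - \<kappa>\<^sup>2 * (A + B)\<^sup>2) ^ k"
  proof (intro mult_left_mono power_mono sum_nonneg prod_nonneg)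
    have "(\<Sum>p\<in>allowed. y (fst p) * y (snd p)) = (2 * \<kappa> * (A + B) + C)\<^sup>2 - 2 * \<kappa>\<^sup>2 * ((real A)\<^sup>2 + (real B)\<^sup>2)"
      unfolding sum_allowed by (simp add: y_def part_size_def power2_eq_square algebra_simps)
    also have "\<dots> \<le> (2 * \<kappa> * (A + B) + C)\<^sup>2 - \<kappa>\<^sup>2 * (A + B)\<^sup>2"
    proof -
      \<comment> \<open>The equal split is the worst case here, which removes the dependence on
        \<open>A\<close> and \<open>B\<close> separately.\<close>
      have "(real (A + B))\<^sup>2 \<le> 2 * ((real A)\<^sup>2 + (real B)\<^sup>2)"
        using zero_le_power2[of "real A - real B"] by (simp add: power2_eq_square algebra_simps)
      then have "\<kappa>\<^sup>2 * (real (A + B))\<^sup>2 \<le> \<kappa>\<^sup>2 * (2 * ((real A)\<^sup>2 + (real B)\<^sup>2))" by (intro mult_left_mono) auto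
      then show ?thesis by (simp add: algebra_simps)
    qed
    finally show "(\<Sum>p\<in>allowed. y (fst p) * y (snd p)) \<le> (2 * \<kappa> * (A + B) + C)\<^sup>2 - \<kappa>\<^sup>2 * (A + B)\<^sup>2" .
  qed (use y0 in auto)
  finally show ?thesis unfolding F Y fact .
qed

lemma power_eq_exp_ln: "0 < (x :: real) \<Longrightarrow> x ^ n = exp (real n * ln x)"
  by (simp add: exp_of_nat_mult)

text \<open>This explains the terms of \<open>rate\<close>: the entropy of placing the classes, with
  the holes split equally, then the powers of \<open>\<kappa>\<close>, then the base of the list
  count. All powers of \<open>N\<close> cancel.\<close>

lemma rate_exponent:
  assumes \<kappa>: "0 < \<kappa>" and L: "0 < L" "2 * L < N" and N: "even (d * N)"
  shows "real N ^ N * ((2 * \<kappa> * L + real (N - 2 * L))\<^sup>2 - \<kappa>\<^sup>2 * (real L)\<^sup>2) ^ (d * N div 2) =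
    exp (N * rate \<kappa> d (L / N)) * ((real L / 2) ^ (2 * L) * real (N - 2 * L) ^ (N - 2 * L) * \<kappa> ^ (2 * d * L) * real N ^ (d * N))"
proof -
  define x where "x = real N"
  define l where "l = real L / x"
  have x: "0 < x" using L by (simp add: x_def)
  have l: "0 < l" "2 * l < 1" using L by (auto simp: l_def x_def field_simps)
  have Lx: "real L = x * l" using x by (simp add: l_def)
  have Cx: "real (N - 2 * L) = x * (1 - 2 * l)" using L x Lx by (simp add: x_def algebra_simps of_nat_diff)
  define q where "q = (2 * \<kappa> * l + (1 - 2 * l))\<^sup>2 - \<kappa>\<^sup>2 * l\<^sup>2"
  have q: "0 < q" unfolding q_def using \<kappa> l by (rule rate_base_pos)
  have Q: "(2 * \<kappa> * L + real (N - 2 * L))\<^sup>2 - \<kappa>\<^sup>2 * (real L)\<^sup>2 = x * x * q"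
    unfolding Cx Lx q_def by (simp add: power2_eq_square algebra_simps)
  have k: "real (d * N div 2) = d * x / 2" using N by (simp add: x_def real_of_nat_div)
  have e1: "x ^ N = exp (x * ln x)" using power_eq_exp_ln[OF x, of N] by (simp add: x_def)
  have e2: "(x * x * q) ^ (d * N div 2) = exp (d * x / 2 * (ln x + ln x + ln q))"
    using power_eq_exp_ln[of "x * x * q" "d * N div 2"] x q by (simp add: k ln_mult_pos)
  have e3: "(real L / 2) ^ (2 * L) = exp (2 * (x * l) * (ln x + ln (l / 2)))"
    using power_eq_exp_ln[of "x * (l / 2)" "2 * L"] x l by (simp add: Lx ln_mult_pos[of x "l / 2", simplified])
  have e4: "real (N - 2 * L) ^ (N - 2 * L) = exp (x * (1 - 2 * l) * (ln x + ln (1 - 2 * l)))"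
    using power_eq_exp_ln[of "x * (1 - 2 * l)" "N - 2 * L"] x l by (simp only: Cx) (simp add: ln_mult_pos)
  have e5: "\<kappa> ^ (2 * d * L) = exp (2 * d * (x * l) * ln \<kappa>)"
    using power_eq_exp_ln[OF \<kappa>, of "2 * d * L"] by (simp add: Lx)
  have e6: "x ^ (d * N) = exp (d * x * ln x)" using power_eq_exp_ln[OF x, of "d * N"] by (simp add: x_def)
  have "x * ln x + d * x / 2 * (ln x + ln x + ln q) =
    x * rate \<kappa> d l + (2 * (x * l) * (ln x + ln (l / 2)) + x * (1 - 2 * l) * (ln x + ln (1 - 2 * l)) + 2 * d * (x * l) * ln \<kappa> + d * x * ln x)"
    unfolding rate_def q_def[symmetric] by (simp add: field_simps)
  then have "x ^ N * (x * x * q) ^ (d * N div 2) = exp (x * rate \<kappa> d l) *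
    ((real L / 2) ^ (2 * L) * real (N - 2 * L) ^ (N - 2 * L) * \<kappa> ^ (2 * d * L) * x ^ (d * N))"
    unfolding e1 e2 e3 e4 e5 e6 by (simp only: exp_add[symmetric])
  then show ?thesis unfolding Q by (simp add: x_def l_def)
qed

text \<open>The tangent bounds for \<open>A\<close> and \<open>B\<close> at the common point
  \<open>(A + B) / 2\<close> carry exponential factors whose product is 1.\<close>

lemma part_product_ge:
  assumes "0 < A + B"
  shows "(real (A + B) / 2) ^ (2 * (A + B)) * real C ^ C \<le> (\<Prod>t<5. real (part_size A B C t) ^ part_size A B C t)"
proof -
  let ?x = "real (A + B) / 2"
  have "0 < real (A + B)" using assms by (simp only: of_nat_0_less_iff)
  then have x: "0 < ?x" by (rule half_gt_zero)
  have "?x ^ (A + B) = (?x ^ A * exp (real A - ?x)) * (?x ^ B * exp (real B - ?x))"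
  proof -
    have "exp (real A - ?x) * exp (real B - ?x) = 1" by (simp flip: exp_add add: field_simps)
    then show ?thesis by (simp only: power_add mult_ac mult_1_right)
  qed
  also have "\<dots> \<le> real A ^ A * real B ^ B"
    by (intro mult_mono power_self_ge x) (use x in auto)
  finally have "(?x ^ (A + B))\<^sup>2 \<le> (real A ^ A * real B ^ B)\<^sup>2" by (intro power_mono) auto
  then have "(?x ^ (A + B))\<^sup>2 * real C ^ C \<le> (real A ^ A * real B ^ B)\<^sup>2 * real C ^ C"
    by (intro mult_right_mono) auto
  also have "\<dots> = (\<Prod>t<5. real (part_size A B C t) ^ part_size A B C t)"
    by (simp add: lessThan_5 part_size_def power2_eq_square mult_ac)
  also have "(?x ^ (A + B))\<^sup>2 = ?x ^ (2 * (A + B))" by (simp flip: power_mult add: mult.commute)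
  finally show ?thesis .
qed

lemma card_reg_configs:
  assumes "even (d * N)"
  shows "real (card (reg_configs N d)) * fact d ^ N = fact (d * N)"
proof -
  have "card (reg_configs N d) * (\<Prod>v<N. fact (if v < N then d else 0)) = fact (2 * (d * N div 2))"
    unfolding reg_configs_def by (rule card_all_configs) (use assms in auto)
  then have "card (reg_configs N d) * fact d ^ N = fact (d * N)" using assms by simp
  then have "real (card (reg_configs N d) * fact d ^ N) = real (fact (d * N))" by (rule arg_cong)
  then show ?thesis by simp
qed

text \<open>The expected count for a fixed split. The list bound is the same for every typing of
  that split, so it is simply multiplied by their number.\<close>

lemma card_typings_hole_configs_le:
  assumes AB: "A + B = L" and \<kappa>: "0 < \<kappa>" and L: "0 < L" "2 * L < N" and N: "even (d * N)"
    and \<tau>: "\<tau> \<in> typings N {..<5} (part_size A B (N - 2 * L))"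
  shows "real (card (typings N {..<5} (part_size A B (N - 2 * L)))) *
      card (configs (hole_pairs N \<tau>) (\<lambda>v. if v < N then d else 0) (d * N div 2))
    \<le> (exp 1 * (real (d * N) + 1)) ^ 5 * card (reg_configs N d) * exp (N * rate \<kappa> d (L / N))"
proof -
  let ?s = "part_size A B (N - 2 * L)"
  define h where "h = real (card (configs (hole_pairs N \<tau>) (\<lambda>v. if v < N then d else 0) (d * N div 2)))"
  define M where "M = real (card (typings N {..<5} ?s))"
  define W where "W = real (card (reg_configs N d))"
  define P where "P = (\<Prod>t<5. real (?s t) ^ ?s t)"
  define K where "K = \<kappa> ^ (2 * d * L)"
  define E where "E = (exp 1 * (real (d * N) + 1)) ^ 5"
  define F where "F = (fact d ^ N :: real)"
  define X where "X = real N ^ (d * N)"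
  define Q where "Q = ((2 * \<kappa> * L + real (N - 2 * L))\<^sup>2 - \<kappa>\<^sup>2 * (real L)\<^sup>2) ^ (d * N div 2)"
  have sum: "(\<Sum>t<5. ?s t) = N" using AB L by (simp add: lessThan_5 part_size_def)
  have P: "0 < P" unfolding P_def by (intro prod_pos) (auto intro: Nat.gr0I)
  have pos: "0 < K" "0 < E" "0 < F" "0 < X" "0 \<le> M" "0 \<le> h" "0 \<le> W"
    using \<kappa> L by (auto simp: K_def E_def F_def X_def M_def h_def W_def intro!: mult_pos_pos add_nonneg_pos)
  have Q: "0 \<le> Q"
  proof -
    have "(\<kappa> * L)\<^sup>2 \<le> (2 * \<kappa> * L + real (N - 2 * L))\<^sup>2"
      using \<kappa> by (intro power_mono) auto
    then show ?thesis unfolding Q_def by (intro zero_le_power) (simp add: power_mult_distrib)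
  qed
  have 1: "M * P \<le> real N ^ N"
  proof -
    have "card (typings N {..<5} ?s) * (\<Prod>t<5. ?s t ^ ?s t) \<le> N ^ N"
      using card_typings_le[of "{..<5}" N ?s] sum by simp
    then have "real (card (typings N {..<5} ?s) * (\<Prod>t<5. ?s t ^ ?s t)) \<le> real (N ^ N)" by (rule of_nat_mono)
    then show ?thesis by (simp add: M_def P_def)
  qed
  have 2: "h * F * (K * P ^ d) \<le> (\<Prod>t<5. fact (d * ?s t)) * Q"
    using hole_configs_le[OF \<tau> \<kappa> refl, of d] unfolding AB h_def F_def K_def P_def Q_def of_nat_power .
  \<comment> \<open>Each of the five class factorials costs one linear factor, together
    \<open>E\<close>.\<close>
  have 3: "(\<Prod>t<5. fact (d * ?s t)) \<le> E * (real d ^ (d * N) * P ^ d * exp (- real (d * N)))"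
  proof -
    have "(\<Prod>t<5. fact (d * ?s t)) \<le> (\<Prod>t<5. (exp 1 * (real (d * N) + 1)) * (real (d * ?s t) ^ (d * ?s t) * exp (- real (d * ?s t))))"
    proof (intro prod_mono conjI)
      fix t assume t: "t \<in> {..<5::nat}"
      have "?s t \<le> (\<Sum>t<5. ?s t)" by (rule member_le_sum) (use t in auto)
      then have "?s t \<le> N" by (simp only: sum)
      then have "d * ?s t \<le> d * N" by simp
      then have "real (d * ?s t) \<le> real (d * N)" by (rule of_nat_mono)
      have "fact (d * ?s t) \<le> exp 1 * (real (d * ?s t) + 1) * (real (d * ?s t) ^ (d * ?s t) * exp (- real (d * ?s t)))"
        by (rule fact_le_power_self)
      also have "\<dots> \<le> exp 1 * (real (d * N) + 1) * (real (d * ?s t) ^ (d * ?s t) * exp (- real (d * ?s t)))"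
        using \<open>real (d * ?s t) \<le> real (d * N)\<close> by (intro mult_right_mono mult_left_mono add_mono) auto
      finally show "fact (d * ?s t) \<le> exp 1 * (real (d * N) + 1) * (real (d * ?s t) ^ (d * ?s t) * exp (- real (d * ?s t)))" .
    qed simp
    also have "\<dots> = E * ((\<Prod>t<5. real (d * ?s t) ^ (d * ?s t)) * (\<Prod>t<5. exp (- real (d * ?s t))))"
      by (simp only: prod.distrib prod_constant card_lessThan E_def power_mult_distrib)
    also have "(\<Prod>t<5. exp (- real (d * ?s t))) = exp (- real (d * N))"
    proof -
      have "(\<Sum>t<5. - real (d * ?s t)) = - real (d * (\<Sum>t<5. ?s t))"
        by (simp add: sum_negf sum_distrib_left)
      then show ?thesis unfolding sum by (simp add: exp_sum[symmetric])
    qed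
    also have "(\<Prod>t<5. real (d * ?s t) ^ (d * ?s t)) = real d ^ (d * N) * P ^ d"
    proof -
      have "(\<Prod>t<5. real (d * ?s t) ^ (d * ?s t)) = (\<Prod>t<5. real d ^ (d * ?s t)) * (\<Prod>t<5. real (?s t) ^ (d * ?s t))"
        by (simp only: of_nat_mult power_mult_distrib prod.distrib)
      also have "(\<Prod>t<5. real d ^ (d * ?s t)) = real d ^ (d * N)"
        by (simp only: power_sum[symmetric] sum_distrib_left[symmetric] sum)
      also have "(\<Prod>t<5. real (?s t) ^ (d * ?s t)) = P ^ d"
        unfolding P_def prod_power_distrib by (intro prod.cong refl) (simp add: power_mult[symmetric] mult.commute)
      finally show ?thesis .
    qed
    finally show ?thesis .
  qed
  have 4: "real d ^ (d * N) * X * exp (- real (d * N)) \<le> W * F"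
    using power_self_le_fact[of "d * N"] card_reg_configs[OF N]
    by (simp add: W_def F_def X_def power_mult_distrib)
  have 5: "(real L / 2) ^ (2 * L) * real (N - 2 * L) ^ (N - 2 * L) \<le> P"
    using part_product_ge[of A B "N - 2 * L"] AB L unfolding P_def by simp
  \<comment> \<open>The \<open>d\<close>-th power of \<open>P\<close> cancels between the variables
    and the class factorials; one more factor \<open>P\<close> is consumed below by the number of
    typings.\<close>
  have "(F * P ^ d) * (h * K * X) = (h * F * (K * P ^ d)) * X" by (simp only: mult_ac)
  also have "\<dots> \<le> ((\<Prod>t<5. fact (d * ?s t)) * Q) * X" using 2 pos by (intro mult_right_mono) auto
  also have "\<dots> \<le> (E * (real d ^ (d * N) * P ^ d * exp (- real (d * N))) * Q) * X"
    using 3 Q pos by (intro mult_right_mono) auto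
  also have "\<dots> = (E * P ^ d * Q) * (real d ^ (d * N) * X * exp (- real (d * N)))" by (simp only: mult_ac)
  also have "\<dots> \<le> (E * P ^ d * Q) * (W * F)" using 4 Q pos P by (intro mult_left_mono) auto
  also have "\<dots> = (F * P ^ d) * (E * W * Q)" by (simp only: mult_ac)
  finally have 6: "h * K * X \<le> E * W * Q" using pos P by (simp only: mult_le_cancel_left_pos zero_less_power mult_pos_pos)
  have "(M * h) * (P * K * X) = (M * P) * (h * K * X)" by (simp only: mult_ac)
  also have "\<dots> \<le> real N ^ N * (E * W * Q)"
    by (rule mult_mono[OF 1 6]) (use pos P in auto)
  also have "\<dots> = E * W * (real N ^ N * Q)" by (simp only: mult_ac)
  also have "\<dots> = E * W * (exp (N * rate \<kappa> d (L / N)) * ((real L / 2) ^ (2 * L) * real (N - 2 * L) ^ (N - 2 * L) * K * X))"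
    unfolding Q_def K_def X_def by (simp only: rate_exponent[OF \<kappa> L N])
  also have "\<dots> \<le> E * W * (exp (N * rate \<kappa> d (L / N)) * (P * K * X))"
    using 5 pos by (intro mult_left_mono mult_right_mono) auto
  also have "\<dots> = (E * W * exp (N * rate \<kappa> d (L / N))) * (P * K * X)" by (simp only: mult_ac)
  finally have "M * h \<le> E * W * exp (N * rate \<kappa> d (L / N))"
    using pos P by (simp only: mult_le_cancel_right_pos mult_pos_pos)
  then show ?thesis by (simp only: M_def h_def E_def W_def)
qed

section \<open>The union bound over holes\<close>

lemma not_arrows_hole_config:
  assumes ps: "ps \<in> reg_configs N d" and na: "\<not> arrows (config_graph N ps) (path_graph n)"
    and L: "2 * L + 2 * n \<le> N + 2" "2 * L \<le> N"
  obtains A \<tau> where "A \<le> L" "\<tau> \<in> typings N {..<5} (part_size A (L - A) (N - 2 * L))"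
    "ps \<in> configs (hole_pairs N \<tau>) (\<lambda>v. if v < N then d else 0) (d * N div 2)"
proof -
  let ?G = "config_graph N ps"
  have V: "verts ?G = {..<N}" and E: "edges ?G = edge ` set ps" by (simp_all add: config_graph_def)
  have finV: "finite (verts ?G)" by (simp add: V)
  obtain S1 S2 S3 S4 where S: "S1 \<subseteq> verts ?G" "S2 \<subseteq> verts ?G" "S3 \<subseteq> verts ?G" "S4 \<subseteq> verts ?G"
    and dis: "S1 \<inter> S2 = {}" "S1 \<inter> S3 = {}" "S1 \<inter> S4 = {}" "S2 \<inter> S3 = {}" "S2 \<inter> S4 = {}" "S3 \<inter> S4 = {}"
    and c: "card S1 = card S2" "card S3 = card S4"
    and big: "card (verts ?G) + 2 \<le> 2 * (card S1 + card S3) + 2 * n"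
    and no: "\<And>x y. x \<in> S1 \<Longrightarrow> y \<in> S2 \<Longrightarrow> {x, y} \<notin> edges ?G"
      "\<And>x y. x \<in> S3 \<Longrightarrow> y \<in> S4 \<Longrightarrow> {x, y} \<notin> edges ?G"
    by (rule not_arrows_path_holes[OF finV na], rule that) assumption+
  have LS: "L \<le> card S1 + card S3" using big L V by simp
  \<comment> \<open>The holes are trimmed to total size exactly \<open>L\<close>: the first supplies
    as much as it can, the second the remainder. Only \<open>A\<close> remains free.\<close>
  define A where "A = min L (card S1)"
  have A: "A \<le> L" "A \<le> card S1" "L - A \<le> card S3" using LS by (auto simp: A_def)
  obtain T1 where T1: "T1 \<subseteq> S1" "card T1 = A" using obtain_subset_with_card_n[OF A(2)] by blast
  obtain T2 where T2: "T2 \<subseteq> S2" "card T2 = A" using obtain_subset_with_card_n[OF A(2)[unfolded c(1)]] by blast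
  obtain T3 where T3: "T3 \<subseteq> S3" "card T3 = L - A" using obtain_subset_with_card_n[OF A(3)] by blast
  obtain T4 where T4: "T4 \<subseteq> S4" "card T4 = L - A" using obtain_subset_with_card_n[OF A(3)[unfolded c(2)]] by blast
  have sub: "T1 \<subseteq> {..<N}" "T2 \<subseteq> {..<N}" "T3 \<subseteq> {..<N}" "T4 \<subseteq> {..<N}"
    by (rule subset_trans[OF T1(1) S(1)[unfolded V]], rule subset_trans[OF T2(1) S(2)[unfolded V]],
        rule subset_trans[OF T3(1) S(3)[unfolded V]], rule subset_trans[OF T4(1) S(4)[unfolded V]])
  have Int_mono_empty: "P' \<inter> Q' = {}" if "P \<inter> Q = {}" "P' \<subseteq> P" "Q' \<subseteq> Q" for P Q P' Q' :: "nat set"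
    using that by blast
  have d: "T1 \<inter> T2 = {}" "T1 \<inter> T3 = {}" "T1 \<inter> T4 = {}" "T2 \<inter> T3 = {}" "T2 \<inter> T4 = {}" "T3 \<inter> T4 = {}"
    by (rule Int_mono_empty[OF dis(1) T1(1) T2(1)], rule Int_mono_empty[OF dis(2) T1(1) T3(1)],
        rule Int_mono_empty[OF dis(3) T1(1) T4(1)], rule Int_mono_empty[OF dis(4) T2(1) T3(1)],
        rule Int_mono_empty[OF dis(5) T2(1) T4(1)], rule Int_mono_empty[OF dis(6) T3(1) T4(1)])
  have fin: "finite T1" "finite T2" "finite T3" "finite T4" using sub by (simp_all add: finite_subset[OF _ finite_lessThan])
  define \<tau> where "\<tau> = (\<lambda>v\<in>{..<N}. if v \<in> T1 then 0 else if v \<in> T2 then 1 else if v \<in> T3 then 2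
     else if v \<in> T4 then 3 else (4 :: nat))"
  have fib: "{v \<in> {..<N}. \<tau> v = 0} = T1" "{v \<in> {..<N}. \<tau> v = 1} = T2" "{v \<in> {..<N}. \<tau> v = 2} = T3"
    "{v \<in> {..<N}. \<tau> v = 3} = T4" "{v \<in> {..<N}. \<tau> v = 4} = {..<N} - (T1 \<union> T2 \<union> T3 \<union> T4)"
    using sub d by (auto simp: \<tau>_def)
  have "card (T1 \<union> T2 \<union> T3 \<union> T4) = card T1 + card T2 + card T3 + card T4"
    using fin d by (simp add: card_Un_disjoint Int_Un_distrib2)
  also have "\<dots> = 2 * L" using T1 T2 T3 T4 A(1) by simp
  finally have c4: "card ({..<N} - (T1 \<union> T2 \<union> T3 \<union> T4)) = N - 2 * L"
    using fin sub by (subst card_Diff_subset) auto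
  have "\<tau> \<in> typings N {..<5} (part_size A (L - A) (N - 2 * L))"
    unfolding typings_def lessThan_5
    using fib c4 T1(2) T2(2) T3(2) T4(2) by (auto simp: part_size_def \<tau>_def)
  moreover have "set ps \<subseteq> hole_pairs N \<tau>"
  proof
    fix p assume p: "p \<in> set ps"
    obtain u v where uv: "p = (u, v)" by (cases p)
    have uvN: "u < N" "v < N" using ps p uv by (auto simp: reg_configs_def configs_def)
    have e: "{u, v} \<in> edges ?G" "{v, u} \<in> edges ?G" using p uv unfolding E by (force simp: insert_commute)+
    have T: "\<tau> w = 0 \<Longrightarrow> w \<in> S1" "\<tau> w = 1 \<Longrightarrow> w \<in> S2" "\<tau> w = 2 \<Longrightarrow> w \<in> S3" "\<tau> w = 3 \<Longrightarrow> w \<in> S4" if "w < N" for w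
      using fib T1(1) T2(1) T3(1) T4(1) that by blast+
    have "(\<tau> u, \<tau> v) \<notin> {(0, 1), (1, 0), (2, 3), (3, 2)}"
      using T[OF uvN(1)] T[OF uvN(2)] no e by auto
    moreover have "\<tau> u < 5" "\<tau> v < 5" using uvN by (auto simp: \<tau>_def)
    ultimately show "p \<in> hole_pairs N \<tau>" using uvN uv by (simp add: hole_pairs_def allowed_def)
  qed
  ultimately show thesis using that[OF A(1)] ps by (auto simp: reg_configs_def configs_def)
qed

lemma prob_not_arrows_le:
  assumes \<kappa>: "0 < \<kappa>" and L: "0 < L" "2 * L < N" "2 * L + 2 * n \<le> N + 2" and N: "even (d * N)"
    and large: "2 * (d * (d + 1)) + d < d * N div 2" "2 \<le> d * N div 2"
  shows "regular_graphs N d \<noteq> {}"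
    "measure_pmf.prob (random_regular_graph N d) {G. \<not> arrows G (path_graph n)} \<le>
      (real L + 1) * (exp 1 * (real (d * N) + 1)) ^ 5 *
      (2 * real (d * N div 2) ^ (4 * (2 * d\<^sup>2 + 32 * d ^ 4) + 2)) * exp (N * rate \<kappa> d (L / N))"
proof -
  define k where "k = d * N div 2"
  define m where "m = 2 * real k ^ (4 * (2 * d\<^sup>2 + 32 * d ^ 4) + 2)"
  define W where "W = real (card (reg_configs N d))"
  define Y where "Y = (exp 1 * (real (d * N) + 1)) ^ 5 * exp (N * rate \<kappa> d (L / N))"
  let ?f = "\<lambda>v. if v < N then d else 0"
  let ?Bad = "{G \<in> regular_graphs N d. \<not> arrows G (path_graph n)}"
  let ?S = "{ps \<in> reg_configs N d. simple_config ps}"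
  let ?SB = "{ps \<in> reg_configs N d. simple_config ps \<and> config_graph N ps \<in> ?Bad}"
  let ?c = "fact k * 2 ^ k :: nat"
  have k: "2 * k = d * N" using N by (simp add: k_def)
  have Y: "0 \<le> Y" by (simp add: Y_def)
  have "d \<noteq> 0" using large by (cases d) auto
  have "card (configs ({..<N} \<times> {..<N}) ?f k) \<le> 2 * k ^ (4 * (2 * d\<^sup>2 + 32 * d ^ 4) + 2) *
      card {ps \<in> configs ({..<N} \<times> {..<N}) ?f k. simple_config ps}"
  proof (rule card_simple_configs_ge)
    show "card {..<N} \<le> 2 * k" using k \<open>d \<noteq> 0\<close> by simp
    show "sum ?f {..<N} = 2 * k" using k by simp
  qed (use large in \<open>auto simp: k_def\<close>)
  then have "card (reg_configs N d) \<le> 2 * k ^ (4 * (2 * d\<^sup>2 + 32 * d ^ 4) + 2) * card ?S"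
    by (simp only: reg_configs_def k_def)
  then have "real (card (reg_configs N d)) \<le> real (2 * k ^ (4 * (2 * d\<^sup>2 + 32 * d ^ 4) + 2) * card ?S)"
    by (rule of_nat_mono)
  then have WS: "W \<le> m * card ?S" by (simp add: W_def m_def)
  have W: "0 < W"
  proof (rule ccontr)
    assume "\<not> 0 < W"
    then have "card (reg_configs N d) = 0" by (simp add: W_def)
    with card_reg_configs[OF N] show False by simp
  qed
  then have S: "0 < card ?S" using WS by (intro Nat.gr0I) auto
  have "?S = {ps \<in> reg_configs N d. simple_config ps \<and> config_graph N ps \<in> regular_graphs N d}"
    using config_graph_regular by auto
  then have cR: "card ?S = card (regular_graphs N d) * ?c"
    using card_regular_graphs_configs[of "regular_graphs N d" N d] by (simp only: k_def subset_refl)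
  show R: "regular_graphs N d \<noteq> {}"
  proof
    assume "regular_graphs N d = {}"
    then have "card ?S = 0" using cR by (simp only: card.empty mult_0)
    with S show False by simp
  qed
  have cB: "card ?SB = card ?Bad * ?c"
    using card_regular_graphs_configs[of ?Bad N d] by (simp add: k_def)
  let ?T = "\<lambda>A. typings N {..<5} (part_size A (L - A) (N - 2 * L))"
  let ?H = "\<lambda>\<tau>. configs (hole_pairs N \<tau>) ?f k"
  have finH: "finite (?H \<tau>)" for \<tau>
  proof -
    have "finite (hole_pairs N \<tau>)"
      by (rule finite_subset[of _ "{..<N} \<times> {..<N}"]) (auto simp: hole_pairs_def)
    then show ?thesis by simp
  qed
  have finT: "finite (?T A)" for A by (intro finite_typings) simp
  have "?SB \<subseteq> (\<Union>A\<in>{..L}. \<Union>\<tau>\<in>?T A. ?H \<tau>)"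
  proof
    fix ps assume "ps \<in> ?SB"
    then have ps: "ps \<in> reg_configs N d" "\<not> arrows (config_graph N ps) (path_graph n)" by auto
    have "2 * L \<le> N" using L by simp
    then obtain A \<tau> where "A \<le> L" "\<tau> \<in> ?T A" "ps \<in> ?H \<tau>"
      using not_arrows_hole_config[OF ps L(3)] unfolding k_def by blast
    then show "ps \<in> (\<Union>A\<in>{..L}. \<Union>\<tau>\<in>?T A. ?H \<tau>)" by blast
  qed
  then have "card ?SB \<le> card (\<Union>A\<in>{..L}. \<Union>\<tau>\<in>?T A. ?H \<tau>)"
    using finT finH by (intro card_mono) auto
  also have "\<dots> \<le> (\<Sum>A\<in>{..L}. card (\<Union>\<tau>\<in>?T A. ?H \<tau>))" by (intro card_UN_le) simp
  also have "\<dots> \<le> (\<Sum>A\<in>{..L}. \<Sum>\<tau>\<in>?T A. card (?H \<tau>))"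
    using finT by (intro sum_mono card_UN_le)
  finally have "real (card ?SB) \<le> real (\<Sum>A\<in>{..L}. \<Sum>\<tau>\<in>?T A. card (?H \<tau>))" by (rule of_nat_mono)
  also have "\<dots> = (\<Sum>A\<in>{..L}. \<Sum>\<tau>\<in>?T A. real (card (?H \<tau>)))" by simp
  also have "\<dots> \<le> (\<Sum>A\<in>{..L}. W * Y)"
  proof (intro sum_mono)
    fix A assume A: "A \<in> {..L}"
    show "(\<Sum>\<tau>\<in>?T A. real (card (?H \<tau>))) \<le> W * Y"
    proof (cases "?T A = {}")
      case True
      have "0 \<le> W * Y" using W Y by simp
      then show ?thesis unfolding True by simp
    next
      case False
      then have T: "0 < real (card (?T A))" using finT by (simp add: card_gt_0_iff)
      \<comment> \<open>The bound for typings times lists is spread equally over the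
        typings.\<close>
      have "(\<Sum>\<tau>\<in>?T A. real (card (?H \<tau>))) \<le> (\<Sum>\<tau>\<in>?T A. W * Y / card (?T A))"
      proof (intro sum_mono)
        fix \<tau> assume \<tau>: "\<tau> \<in> ?T A"
        have "A + (L - A) = L" using A by simp
        from card_typings_hole_configs_le[OF this \<kappa> L(1,2) N \<tau>]
        have "real (card (?T A)) * card (?H \<tau>) \<le> W * Y" by (simp only: k_def W_def Y_def mult_ac)
        then show "real (card (?H \<tau>)) \<le> W * Y / card (?T A)" using T by (simp only: pos_le_divide_eq mult.commute)
      qed
      also have "\<dots> = W * Y" using T by simp
      finally show ?thesis .
    qed
  qed
  also have "\<dots> = (real L + 1) * Y * W" by (simp add: algebra_simps)
  also have "\<dots> \<le> (real L + 1) * Y * (m * card ?S)" using WS Y by (intro mult_left_mono) auto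
  finally have SB: "real (card ?SB) \<le> (real L + 1) * Y * m * card ?S" by (simp only: mult.assoc)
  have "measure_pmf.prob (random_regular_graph N d) {G. \<not> arrows G (path_graph n)} =
      card (regular_graphs N d \<inter> {G. \<not> arrows G (path_graph n)}) / card (regular_graphs N d)"
    unfolding random_regular_graph_def using R by (intro measure_pmf_of_set) auto
  also have "regular_graphs N d \<inter> {G. \<not> arrows G (path_graph n)} = ?Bad" by auto
  \<comment> \<open>The number of codes per graph cancels, so the probability may be computed among
    simple configurations.\<close>
  also have "card ?Bad / card (regular_graphs N d) = card ?SB / card ?S"
    unfolding cB cR by simp
  also have "\<dots> \<le> (real L + 1) * Y * m" using SB S by (simp add: pos_divide_le_eq)
  finally show "measure_pmf.prob (random_regular_graph N d) {G. \<not> arrows G (path_graph n)} \<le>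
      (real L + 1) * (exp 1 * (real (d * N) + 1)) ^ 5 *
      (2 * real (d * N div 2) ^ (4 * (2 * d\<^sup>2 + 32 * d ^ 4) + 2)) * exp (N * rate \<kappa> d (L / N))"
    by (simp only: Y_def m_def k_def mult_ac)
qed

section \<open>Asymptotics\<close>

lemma tendsto_power_times_exp:
  assumes "0 < (\<eta> :: real)"
  shows "((\<lambda>x. x ^ q * exp (- (\<eta> * x))) \<longlongrightarrow> 0) at_top"
proof -
  have "filterlim (\<lambda>x. \<eta> * x) at_top at_top"
    using assms by (intro filterlim_tendsto_pos_mult_at_top[OF tendsto_const _ filterlim_ident])
  then have "((\<lambda>x. (\<eta> * x) ^ q / exp (\<eta> * x)) \<longlongrightarrow> 0) at_top"
    by (rule filterlim_compose[OF tendsto_power_div_exp_0])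
  then have "((\<lambda>x. inverse (\<eta> ^ q) * ((\<eta> * x) ^ q / exp (\<eta> * x))) \<longlongrightarrow> inverse (\<eta> ^ q) * 0) at_top"
    by (intro tendsto_mult tendsto_const)
  then show ?thesis using assms by (simp add: power_mult_distrib exp_minus field_simps)
qed

lemma prob_not_arrows_tendsto_0:
  fixes N :: "nat \<Rightarrow> nat"
  assumes \<kappa>: "0 < \<kappa>" and s: "0 < s" "2 * s < 1" and rate: "rate \<kappa> d s < 0" and d: "0 < d"
    and N: "filterlim N at_top sequentially" and ev: "\<And>n. even (d * N n)"
    and size: "\<And>n. 2 * nat \<lfloor>s * N n\<rfloor> + 2 * n \<le> N n + 2"
  shows "\<forall>\<^sub>F n in sequentially. regular_graphs (N n) d \<noteq> {}"
    "(\<lambda>n. measure_pmf.prob (random_regular_graph (N n) d) {G. \<not> arrows G (path_graph n)}) \<longlonglongrightarrow> 0"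
proof -
  define L where "L n = nat \<lfloor>s * N n\<rfloor>" for n
  \<comment> \<open>\<open>L n / N n\<close> only converges to \<open>s\<close>; by continuity of
    the rate, half of its value at \<open>s\<close> eventually remains as decay.\<close>
  define \<eta> where "\<eta> = - rate \<kappa> d s / 2"
  define p where "p = 4 * (2 * d\<^sup>2 + 32 * d ^ 4) + 2"
  define C where "C = 2 * (exp 1 * (real d + 1)) ^ 5 * (2 * real d ^ p)"
  let ?x = "\<lambda>n. real (N n)"
  let ?P = "\<lambda>n. measure_pmf.prob (random_regular_graph (N n) d) {G. \<not> arrows G (path_graph n)}"
  have \<eta>: "0 < \<eta>" using rate by (simp add: \<eta>_def)
  have x: "filterlim ?x at_top sequentially"
    by (rule filterlim_compose[OF filterlim_real_sequentially N])
  have big: "\<forall>\<^sub>F n in sequentially. M \<le> N n" for M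
    using N by (simp add: filterlim_at_top)
  have L_bounds: "real (L n) \<le> s * N n" "s * N n - 1 \<le> real (L n)" for n
    using s by (auto simp: L_def of_nat_nat floor_mono[of 0])
  have lim: "(\<lambda>n. real (L n) / N n) \<longlonglongrightarrow> s"
  proof (rule tendsto_sandwich)
    show "\<forall>\<^sub>F n in sequentially. s - 1 / N n \<le> real (L n) / N n"
      using big[of 1]
    proof eventually_elim
      case (elim n)
      then have "s - 1 / N n = (s * N n - 1) / N n" by (simp add: diff_divide_distrib)
      also have "\<dots> \<le> real (L n) / N n" by (intro divide_right_mono L_bounds) simp
      finally show ?case .
    qed
    show "\<forall>\<^sub>F n in sequentially. real (L n) / N n \<le> s"
      using big[of 1]
    proof eventually_elim
      case (elim n)
      then show ?case using L_bounds(1)[of n] by (simp add: field_simps)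
    qed
    have "(\<lambda>n. s - 1 / N n) \<longlonglongrightarrow> s - 0"
      by (intro tendsto_diff tendsto_const tendsto_divide_0[OF tendsto_const] filterlim_at_top_imp_at_infinity x)
    then show "(\<lambda>n. s - 1 / N n) \<longlonglongrightarrow> s" by simp
  qed auto
  have "(\<lambda>n. rate \<kappa> d (real (L n) / N n)) \<longlonglongrightarrow> rate \<kappa> d s"
    by (rule isCont_tendsto_compose[OF continuous_rate[OF \<kappa> s] lim])
  moreover have "rate \<kappa> d s < - \<eta>" using rate by (simp add: \<eta>_def)
  ultimately have rate_ev: "\<forall>\<^sub>F n in sequentially. rate \<kappa> d (real (L n) / N n) < - \<eta>"
    by (rule order_tendstoD(2))
  have L_pos: "\<forall>\<^sub>F n in sequentially. 0 < L n"
    using big[of "nat \<lceil>2 / s\<rceil>"]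
  proof eventually_elim
    case (elim n)
    then have "2 / s \<le> N n" by linarith
    then have "2 \<le> s * N n" using s by (simp add: field_simps)
    then have "1 \<le> real (L n)" using L_bounds(2)[of n] by linarith
    then show ?case by simp
  qed
  have large: "\<forall>\<^sub>F n in sequentially. 2 * (d * (d + 1)) + d + 2 < d * N n div 2"
    using big[of "2 * (2 * (d * (d + 1)) + d + 3)"]
  proof eventually_elim
    case (elim n)
    have "2 * (2 * (d * (d + 1)) + d + 3) \<le> 1 * N n" using elim by simp
    also have "\<dots> \<le> d * N n" using d by (intro mult_le_mono1) simp
    finally have "2 * (2 * (d * (d + 1)) + d + 3) div 2 \<le> d * N n div 2" by (rule div_le_mono)
    then show ?case by simp
  qed
  \<comment> \<open>The exponent \<open>p + 6\<close> collects one power from the number of splits,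
    five from the class factorials and \<open>p\<close> from the restriction to simple
    lists.\<close>
  have key: "\<forall>\<^sub>F n in sequentially. regular_graphs (N n) d \<noteq> {} \<and> ?P n \<le> C * (?x n ^ (p + 6) * exp (- (\<eta> * ?x n)))"
    using rate_ev L_pos large big[of 1]
  proof eventually_elim
    case (elim n)
    define y where "y = ?x n"
    have y: "1 \<le> y" using elim by (simp add: y_def)
    have L2: "2 * L n < N n"
    proof -
      have "2 * real (L n) \<le> (2 * s) * y" using L_bounds(1)[of n] by (simp add: y_def)
      also have "\<dots> < 1 * y" using s y by (intro mult_strict_right_mono) auto
      finally show ?thesis by (simp add: y_def)
    qed
    have size': "2 * L n + 2 * n \<le> N n + 2" using size[of n] by (simp add: L_def)
    have 1: "2 * (d * (d + 1)) + d < d * N n div 2" "2 \<le> d * N n div 2" using elim(3) by auto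
    note main = prob_not_arrows_le[OF \<kappa> elim(2) L2 size' ev 1, folded p_def]
    have "real (d * N n div 2) \<le> real (d * N n)" by (intro of_nat_mono) simp
    then have k: "real (d * N n div 2) \<le> real d * y" by (simp add: y_def)
    have dy: "real (d * N n) + 1 \<le> (real d + 1) * y" using y by (simp add: y_def algebra_simps)
    have Ly: "real (L n) + 1 \<le> 2 * y" using L2 y by (simp add: y_def)
    have "y * rate \<kappa> d (real (L n) / N n) \<le> y * (- \<eta>)"
      using elim(1) y by (intro mult_left_mono) auto
    then have r: "exp (N n * rate \<kappa> d (real (L n) / N n)) \<le> exp (- (\<eta> * y))" by (simp add: y_def mult.commute)
    have "?P n \<le> (real (L n) + 1) * (exp 1 * (real (d * N n) + 1)) ^ 5 *
      (2 * real (d * N n div 2) ^ p) * exp (N n * rate \<kappa> d (real (L n) / N n))" by (rule main(2))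
    also have "\<dots> \<le> (2 * y) * (exp 1 * ((real d + 1) * y)) ^ 5 * (2 * (real d * y) ^ p) * exp (- (\<eta> * y))"
      using y by (intro mult_mono power_mono Ly dy k r order_refl) (auto intro!: mult_nonneg_nonneg add_nonneg_nonneg)
    also have "\<dots> = C * (y ^ (p + 6) * exp (- (\<eta> * y)))"
      by (simp add: C_def power_mult_distrib power_add mult_ac eval_nat_numeral)
    finally show ?case using main(1) by (simp add: y_def)
  qed
  then show "\<forall>\<^sub>F n in sequentially. regular_graphs (N n) d \<noteq> {}" by (rule eventually_mono) simp
  show "?P \<longlonglongrightarrow> 0"
  proof (rule tendsto_sandwich)
    show "\<forall>\<^sub>F n in sequentially. 0 \<le> ?P n" by simp
    show "\<forall>\<^sub>F n in sequentially. ?P n \<le> C * (?x n ^ (p + 6) * exp (- (\<eta> * ?x n)))"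
      using key by (rule eventually_mono) simp
    have "(\<lambda>n. C * (?x n ^ (p + 6) * exp (- (\<eta> * ?x n)))) \<longlonglongrightarrow> C * 0"
      by (intro tendsto_mult tendsto_const filterlim_compose[OF tendsto_power_times_exp[OF \<eta>] x])
    then show "(\<lambda>n. C * (?x n ^ (p + 6) * exp (- (\<eta> * ?x n)))) \<longlonglongrightarrow> 0" by simp
  qed simp
qed

section \<open>The path Ramsey property of random regular graphs and the size Ramsey number\<close>

lemma card_edges_regular:
  assumes "G \<in> regular_graphs N d"
  shows "card (edges G) = d * N div 2"
proof -
  have fin: "finite (edges G)"
    using assms by (intro finite_subset[of "edges G" "Pow {..<N}"]) (auto simp: regular_graphs_def simple_graph_def)
  have "card e = 2" if "e \<in> edges G" for e using assms that by (auto simp: regular_graphs_def simple_graph_def)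
  note en = card_edge_enumerations[OF fin this]
  then have "card {ps. simple_config ps \<and> edge ` set ps = edges G} \<noteq> 0" by simp
  then have "{ps. simple_config ps \<and> edge ` set ps = edges G} \<noteq> {}" by (intro notI) (simp only: card.empty)
  then obtain ps where "simple_config ps" "edge ` set ps = edges G" by blast
  from config_of_regular(1,3)[OF assms this] show ?thesis by (simp add: reg_configs_def configs_def)
qed

lemma size_ramsey_le:
  assumes "G \<in> regular_graphs N d" "arrows G H"
  shows "size_ramsey H \<le> d * N div 2"
  unfolding size_ramsey_def
proof (rule Least_le, intro exI conjI)
  show "finite (verts G)" "simple_graph G" using assms(1) by (auto simp: regular_graphs_def)
qed (use assms card_edges_regular in auto)

lemma random_regular_path_ramsey:
  fixes N :: "nat \<Rightarrow> nat"
  assumes c: "c = 5.4806" and d: "d = 27" and N: "\<And>n. even_rounding (c * real n) (N n)"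
  shows "\<forall>\<^sub>F n in sequentially. regular_graphs (N n) d \<noteq> {}"
    "(\<lambda>n. measure_pmf.prob (random_regular_graph (N n) d) {G. arrows G (path_graph n)}) \<longlonglongrightarrow> 1"
proof -
  have near: "even (N n)" "\<bar>real (N n) - c * real n\<bar> < 2" for n
    using N[of n] by (auto simp: even_rounding_def)
  have lim: "filterlim N at_top sequentially"
    unfolding filterlim_at_top
  proof
    fix Z
    show "\<forall>\<^sub>F n in sequentially. Z \<le> N n"
      using eventually_ge_at_top[of "Z + 2"]
    proof eventually_elim
      case (elim n)
      have "1 * real n \<le> c * real n" by (intro mult_right_mono) (auto simp: c)
      moreover have "real Z + 2 \<le> real n" using of_nat_mono[OF elim, where 'a = real] by simp
      ultimately have "real Z + 2 \<le> c * n" by linarith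
      then have "real Z \<le> real (N n)" using near(2)[of n] by linarith
      then show ?case by simp
    qed
  qed
  \<comment> \<open>The two spare vertices in the bound for the holes absorb the rounding of
    \<open>c * n\<close> to an even integer.\<close>
  have size: "2 * nat \<lfloor>158769 / 500000 * N n\<rfloor> + 2 * n \<le> N n + 2" for n
  proof -
    have "real (nat \<lfloor>158769 / 500000 * N n\<rfloor>) \<le> 158769 / 500000 * N n" by (intro of_nat_floor) simp
    moreover have "5.4806 * real n \<le> real (N n) + 2" using near(2)[of n] unfolding c by linarith
    ultimately have "2 * real (nat \<lfloor>158769 / 500000 * N n\<rfloor>) + 2 * n \<le> real (N n) + 2" by (simp add: field_simps)
    then show ?thesis by linarith
  qed
  have rate: "rate (65 / 54) d (158769 / 500000) < 0" using rate_negative unfolding d by simp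
  have "0 < d" using d by simp
  have ev: "even (d * N n)" for n using near(1) by simp
  have zero: "(\<lambda>n. measure_pmf.prob (random_regular_graph (N n) d) {G. \<not> arrows G (path_graph n)}) \<longlonglongrightarrow> 0"
    by (rule prob_not_arrows_tendsto_0(2)[OF _ _ _ rate \<open>0 < d\<close> lim ev size]) simp_all
  show "\<forall>\<^sub>F n in sequentially. regular_graphs (N n) d \<noteq> {}"
    by (rule prob_not_arrows_tendsto_0(1)[OF _ _ _ rate \<open>0 < d\<close> lim ev size]) simp_all
  have compl: "measure_pmf.prob M {G. arrows G (path_graph n)} = 1 - measure_pmf.prob M {G. \<not> arrows G (path_graph n)}"
    for M :: "nat graph pmf" and n
    using measure_pmf.prob_compl[of "{G. \<not> arrows G (path_graph n)}" M]
    by (simp add: Collect_neg_eq[symmetric] Compl_eq_Diff_UNIV[symmetric])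
  have "(\<lambda>n. 1 - measure_pmf.prob (random_regular_graph (N n) d) {G. \<not> arrows G (path_graph n)}) \<longlonglongrightarrow> 1 - 0"
    by (intro tendsto_diff tendsto_const zero)
  then show "(\<lambda>n. measure_pmf.prob (random_regular_graph (N n) d) {G. arrows G (path_graph n)}) \<longlonglongrightarrow> 1"
    by (simp only: compl diff_zero)
qed

theorem theorem3p6:
  fixes c :: real and d :: nat
  assumes "c = 5.4806" and "d = 27"
  shows "(\<forall>N :: nat \<Rightarrow> nat. (\<forall>n. even_rounding (c * real n) (N n)) \<longrightarrow>
            (\<lambda>n. measure_pmf.prob (random_regular_graph (N n) d) {G. arrows G (path_graph n)})
              \<longlonglongrightarrow> 1) \<and>
         (\<forall>\<^sub>F n in sequentially. real (size_ramsey (path_graph n)) < 74 * real n)"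
proof (intro conjI allI impI)
  fix N :: "nat \<Rightarrow> nat"
  assume "\<forall>n. even_rounding (c * real n) (N n)"
  then show "(\<lambda>n. measure_pmf.prob (random_regular_graph (N n) d) {G. arrows G (path_graph n)}) \<longlonglongrightarrow> 1"
    using random_regular_path_ramsey(2)[OF assms] by blast
next
  \<comment> \<open>Rounding down keeps the number of edges at most
    \<open>d * c * n / 2\<close>.\<close>
  define N where "N n = 2 * nat \<lfloor>c * real n / 2\<rfloor>" for n
  have N_le: "real (N n) \<le> c * n" "c * n - 2 < real (N n)" for n
  proof -
    have "0 \<le> c * real n / 2" using assms(1) by simp
    then have "real (N n) = 2 * of_int \<lfloor>c * real n / 2\<rfloor>" by (simp add: N_def of_nat_nat)
    then show "real (N n) \<le> c * n" "c * n - 2 < real (N n)" by linarith+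
  qed
  have N: "even_rounding (c * real n) (N n)" for n
    using N_le[of n] by (auto simp: even_rounding_def N_def)
  note ramsey = random_regular_path_ramsey[OF assms N]
  show "\<forall>\<^sub>F n in sequentially. real (size_ramsey (path_graph n)) < 74 * real n"
    \<comment> \<open>Existence of regular graphs is drawn on because \<open>pmf_of_set\<close> says
      nothing for the empty set; only with it does a positive probability yield a regular
      graph.\<close>
    using ramsey(1) order_tendstoD(1)[OF ramsey(2) zero_less_one] eventually_gt_at_top[of 0]
  proof eventually_elim
    case (elim n)
    have "regular_graphs (N n) d \<inter> {G. arrows G (path_graph n)} \<noteq> {}"
    proof
      assume "regular_graphs (N n) d \<inter> {G. arrows G (path_graph n)} = {}"
      then have "measure_pmf.prob (random_regular_graph (N n) d) {G. arrows G (path_graph n)} = 0"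
        unfolding random_regular_graph_def using elim(1) by (subst measure_pmf_of_set) auto
      with elim(2) show False by simp
    qed
    then obtain G where "G \<in> regular_graphs (N n) d" "arrows G (path_graph n)" by blast
    then have "size_ramsey (path_graph n) \<le> d * N n div 2" by (rule size_ramsey_le)
    then have "2 * size_ramsey (path_graph n) \<le> d * N n" by linarith
    then have "real (2 * size_ramsey (path_graph n)) \<le> real (d * N n)" by (rule of_nat_mono)
    then have "2 * real (size_ramsey (path_graph n)) \<le> 27 * real (N n)" by (simp add: assms(2))
    also have "\<dots> \<le> 27 * (c * n)" using N_le(1)[of n] by simp
    \<comment> \<open>Here \<open>27 * 5.4806 = 147.9762\<close>, just below
      \<open>2 * 74\<close>.\<close>
    also have "\<dots> < 148 * real n" using elim(3) by (simp add: assms(1))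
    finally show ?case by simp
  qed
qed

end
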